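(* Let $K\in\mathbb{R}^{m\times n}$ be given and consider the hybrid system $\mathcal{H}_{cl}$ and the set $\mathcal{A}$ described in the context. Suppose there exist $W\in\mathbb{S}^{n}_+$, $R_1\in\mathbb{S}^{n_1}_+,\dots,R_q\in\mathbb{S}^{n_q}_+$, $S\in\mathbb{D}^{m}_+$, real numbers $\sigma_1,\dots,\sigma_q>0$ and $\bar\mu>0$, and matrices $Z,J\in\mathbb{R}^{m\times n}$ such that $$\begin{bmatrix} W & 0 & Z_{(i)}^{\mathsf T}\\ \star & \bigoplus_{j=1}^q R_j & J_{(i)}^{\mathsf T}\\ \star&\star&\frac{\bar u_i^2}{\bar\mu}\end{bmatrix}\succeq 0\qquad \forall i\in\{1,\dots,m\},$$ and, for all $\tau\in\mathcal{T}$, $$\mathfrak{M}(\tau):=\begin{bmatrix}\operatorname{He}((A+BK)W) & -BK & BS-WK^{\mathsf T}-Z^{\mathsf T}\\ \star & \operatorname{He}(R(\tau)A)-\Sigma R(\tau) & K^{\mathsf T}-J^{\mathsf T}\\ \star&\star&-2S\end{bmatrix}\prec 0,$$ where $R(\tau):=\bigoplus_{j=1}^q e^{\sigma_j\tau_j}R_j$ and $\Sigma:=\bigoplus_{j=1}^q\sigma_j\mathbf{I}_{n_j}$. Then the set $\mathcal{A}$ is exponentially stable for $\mathcal{H}_{cl}$, and the set $$\mathcal{Q}_{\bar\mu}:=\{x=(\bar x,\tau)\in\mathcal{C}:\ \bar x^{\mathsf T}\widehat P(\tau)\bar x\le\bar\mu\},\qquad \widehat P(\tau):=W^{-1}\oplus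 R(\tau),$$ is included in the basin of attraction of $\mathcal{A}$. In particular, there exist $\lambda,\kappa>0$ such that every maximal solution $\phi$ of $\mathcal{H}_{cl}$ with $\phi(0,0)\in\mathcal{Q}_{\bar\mu}$ satisfies $|\phi(t,j)|_{\mathcal{A}}\le\kappa e^{-\lambda(t+j)}|\phi(0,0)|_{\mathcal{A}}$ for all $(t,j)\in\operatorname{dom}\phi$.
   Context: Notation: $\mathbb{S}^k_+$ is the set of $k\times k$ symmetric positive definite matrices; $\mathbb{D}^m_+$ the set of $m\times m$ diagonal positive definite matrices; $\operatorname{He}(M)=M+M^{\mathsf T}$; $\bigoplus$ denotes block-diagonal direct sum; $\star$ denotes symmetric blocks; $M_{(i)}$ is the $i$-th row of a matrix $M$; $\mathbf{1}_q$ is the all-ones vector in $\mathbb{R}^q$. Setting: fix integers $n,m\ge1$, $1\le q\le n$, and $n_1,\dots,n_q\ge1$ with $n_1+\dots+n_q=n$; let $\mathcal{N}=\{1,\dots,q\}$. Let $A\in\mathbb{R}^{n\times n}$, $B\in\mathbb{R}^{n\times m}$, $\bar u=(\bar u_1,\dots,\bar u_m)$ with $\bar u_i>0$, and for each $i\in\mathcal{N}$ positive reals $T_1^{(i)}\le T_2^{(i)}$. Define $\mathfrak{sat}_{\bar u}(v)=(\operatorname{sat}_1(v_1),\dots,\operatorname{sat}_m(v_m))$ with $\operatorname{sat}_i(s)=\min(|s|,\bar u_i)\operatorname{sign}(s)$, and the deadzone $\mathfrak{dz}_{\bar u}(y)=\mathfrak{sat}_{\bar u}(y)-y$. For $K\in\mathbb{R}^{m\times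 n}$ let $A_{cl}=\begin{bmatrix}A+BK&-BK\\0&A\end{bmatrix}$, $B_{cl}=\begin{bmatrix}B\\0\end{bmatrix}$, $K_{cl}=\begin{bmatrix}K&-K\end{bmatrix}$. The state is $x=(x_p,\tilde\eta,\tau)\in\mathbb{R}^n\times\mathbb{R}^n\times\mathbb{R}^q$, $\bar x=(x_p,\tilde\eta)$, with $\tilde\eta=(\tilde\eta^{(1)},\dots,\tilde\eta^{(q)})$, $\tilde\eta^{(i)}\in\mathbb{R}^{n_i}$. Let $\mathcal{T}=[0,T_2^{(1)}]\times\dots\times[0,T_2^{(q)}]$. The hybrid system $\mathcal{H}_{cl}$ is $\dot x=f(x)$ for $x\in\mathcal{C}$, $x^+\in G(x)$ for $x\in\mathcal{D}$, where $\mathcal{C}=\mathbb{R}^{2n}\times\mathcal{T}$, $f(x)=(A_{cl}\bar x+B_{cl}\mathfrak{dz}_{\bar u}(K_{cl}\bar x),-\mathbf{1}_q)$; $\mathcal{D}_i=\{\tau\in\mathcal{T}:\tau_i=0\}$, $\mathcal{D}=\mathbb{R}^{2n}\times\bigcup_{i\in\mathcal{N}}\mathcal{D}_i$; $h_i(\tilde\eta)$ is the vector obtained from $\tilde\eta$ by replacing the block $\tilde\eta^{(i)}$ by $0$ and keeping the other blocks; $\widehat{\mathcal{G}}_i(\tau)=\{\chi\in\mathbb{R}^q:\chi_i\in[T_1^{(i)},T_2^{(i)}],\ \chi_k=\tau_k\ \forall k\ne i\}$; and $G(x)=\bigcup_{i\in\mathcal{N}:\,\tau\in\mathcal{D}_i}\{x_p\}\times\{h_i(\tilde\eta)\}\times\widehat{\mathcal{G}}_i(\tau)$.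 Solutions are hybrid arcs in the sense of Goebel–Sanfelice–Teel (defined on hybrid time domains, flowing in $\mathcal{C}$ according to $f$ and jumping from $\mathcal{D}$ according to $G$); maximal means not extendable, complete means unbounded domain. Let $\mathcal{A}=\{0\}\times\mathcal{T}\subset\mathbb{R}^{2n}\times\mathbb{R}^q$ and $|x|_{\mathcal{A}}$ the Euclidean distance from $x$ to $\mathcal{A}$. $\mathcal{A}$ is exponentially stable if there exist $\kappa,\lambda,\mu>0$ such that every maximal solution $\phi$ with $|\phi(0,0)|_{\mathcal{A}}\le\mu$ is complete and satisfies $|\phi(t,j)|_{\mathcal{A}}\le\kappa e^{-\lambda(t+j)}|\phi(0,0)|_{\mathcal{A}}$ for all $(t,j)\in\operatorname{dom}\phi$. The basin of attraction of $\mathcal{A}$ is the set of points from which every maximal solution is complete and converges to $\mathcal{A}$. *)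

theory Defs
  imports "HOL-Analysis.Analysis"
begin

definition slice :: "(real \<times> nat) set \<Rightarrow> nat \<Rightarrow> real set" where
  "slice E j = {t. (t, j) \<in> E}"

definition hybrid_time_domain :: "(real \<times> nat) set \<Rightarrow> bool" where
  "hybrid_time_domain E \<longleftrightarrow>
     E \<subseteq> {0..} \<times> UNIV \<and> (0, 0) \<in> E \<and>
     (\<forall>j. is_interval (slice E j)) \<and>
     (\<forall>j. slice E (Suc j) \<noteq> {} \<longrightarrow>
          slice E j \<noteq> {} \<and> compact (slice E j) \<and>
          Sup (slice E j) \<in> slice E (Suc j) \<and>
          (\<forall>t\<in>slice E (Suc j). Sup (slice E j) \<le> t))"

text \<open>Solution pair (E, phi): phi is only relevant on E. Since the flow map is
  continuous, "locally absolutely continuous with derivative in F a.e." is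
  equivalent to continuity on each slice plus the differential equation in the
  interior of each slice.\<close>
definition hybrid_solution ::
  "'s::real_normed_vector set \<Rightarrow> ('s \<Rightarrow> 's) \<Rightarrow> 's set \<Rightarrow> ('s \<Rightarrow> 's set) \<Rightarrow>
   (real \<times> nat) set \<Rightarrow> (real \<times> nat \<Rightarrow> 's) \<Rightarrow> bool" where
  "hybrid_solution C f D G E \<phi> \<longleftrightarrow>
     hybrid_time_domain E \<and> \<phi> (0, 0) \<in> closure C \<union> D \<and>
     (\<forall>j. continuous_on (slice E j) (\<lambda>t. \<phi> (t, j)) \<and>
          (\<forall>t\<in>interior (slice E j). \<phi> (t, j) \<in> C \<and>
              ((\<lambda>s. \<phi> (s, j)) has_vector_derivative f (\<phi> (t, j))) (at t))) \<and>
     (\<forall>t j. (t, j) \<in> E \<and> (t, Suc j) \<in> E \<longrightarrow>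
          \<phi> (t, j) \<in> D \<and> \<phi> (t, Suc j) \<in> G (\<phi> (t, j)))"

definition maximal_solution ::
  "'s::real_normed_vector set \<Rightarrow> ('s \<Rightarrow> 's) \<Rightarrow> 's set \<Rightarrow> ('s \<Rightarrow> 's set) \<Rightarrow>
   (real \<times> nat) set \<Rightarrow> (real \<times> nat \<Rightarrow> 's) \<Rightarrow> bool" where
  "maximal_solution C f D G E \<phi> \<longleftrightarrow>
     hybrid_solution C f D G E \<phi> \<and>
     \<not> (\<exists>E' \<psi>. hybrid_solution C f D G E' \<psi> \<and> E \<subset> E' \<and> (\<forall>p\<in>E. \<psi> p = \<phi> p))"

definition complete_domain :: "(real \<times> nat) set \<Rightarrow> bool" where
  "complete_domain E \<longleftrightarrow> (\<forall>M. \<exists>(t, j)\<in>E. t + real j > M)"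

definition exp_stable ::
  "'s::real_normed_vector set \<Rightarrow> ('s \<Rightarrow> 's) \<Rightarrow> 's set \<Rightarrow> ('s \<Rightarrow> 's set) \<Rightarrow> 's set \<Rightarrow> bool" where
  "exp_stable C f D G \<A> \<longleftrightarrow>
     (\<exists>\<kappa>>0. \<exists>lam>0. \<exists>\<mu>>0. \<forall>E \<phi>.
        maximal_solution C f D G E \<phi> \<and> infdist (\<phi> (0, 0)) \<A> \<le> \<mu> \<longrightarrow>
          complete_domain E \<and>
          (\<forall>(t, j)\<in>E. infdist (\<phi> (t, j)) \<A> \<le> \<kappa> * exp (- lam * (t + real j)) * infdist (\<phi> (0, 0)) \<A>))"

definition basin ::
  "'s::real_normed_vector set \<Rightarrow> ('s \<Rightarrow> 's) \<Rightarrow> 's set \<Rightarrow> ('s \<Rightarrow> 's set) \<Rightarrow> 's set \<Rightarrow> 's set" where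
  "basin C f D G \<A> = {x. \<forall>E \<phi>. maximal_solution C f D G E \<phi> \<and> \<phi> (0, 0) = x \<longrightarrow>
       complete_domain E \<and>
       (\<forall>\<epsilon>>0. \<exists>M. \<forall>(t, j)\<in>E. t + real j \<ge> M \<longrightarrow> infdist (\<phi> (t, j)) \<A> < \<epsilon>)}"

definition sat :: "real^'m \<Rightarrow> real^'m \<Rightarrow> real^'m" where
  "sat ub v = (\<chi> i. min \<bar>v$i\<bar> (ub$i) * sgn (v$i))"

definition dz :: "real^'m \<Rightarrow> real^'m \<Rightarrow> real^'m" where
  "dz ub v = sat ub v - v"

definition Tset :: "('q::finite \<Rightarrow> real) \<Rightarrow> (real^'q) set" where
  "Tset T2 = {\<tau>. \<forall>i. 0 \<le> \<tau>$i \<and> \<tau>$i \<le> T2 i}"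

definition Ccl :: "('q::finite \<Rightarrow> real) \<Rightarrow> ((real^'n) \<times> (real^'n) \<times> (real^'q)) set" where
  "Ccl T2 = UNIV \<times> UNIV \<times> Tset T2"

definition fcl :: "real^'n^'n \<Rightarrow> real^'m^'n \<Rightarrow> real^'n^'m \<Rightarrow> real^'m \<Rightarrow>
    (real^'n) \<times> (real^'n) \<times> (real^'q) \<Rightarrow> (real^'n) \<times> (real^'n) \<times> (real^'q)" where
  "fcl A B K ub = (\<lambda>(xp, \<eta>, \<tau>).
     ((A + B ** K) *v xp - (B ** K) *v \<eta> + B *v dz ub (K *v xp - K *v \<eta>),
      A *v \<eta>,
      - (\<chi> i. 1)))"

definition Dset :: "('q::finite \<Rightarrow> real) \<Rightarrow> 'q \<Rightarrow> (real^'q) set" where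
  "Dset T2 i = {\<tau> \<in> Tset T2. \<tau>$i = 0}"

definition Dcl :: "('q::finite \<Rightarrow> real) \<Rightarrow> ((real^'n) \<times> (real^'n) \<times> (real^'q)) set" where
  "Dcl T2 = UNIV \<times> UNIV \<times> (\<Union>i. Dset T2 i)"

text \<open>Block structure of eta: coordinate k of eta belongs to block blk k.\<close>
definition hmap :: "('n \<Rightarrow> 'q) \<Rightarrow> 'q \<Rightarrow> real^'n \<Rightarrow> real^'n" where
  "hmap blk i \<eta> = (\<chi> k. if blk k = i then 0 else \<eta>$k)"

definition Ghat :: "('q::finite \<Rightarrow> real) \<Rightarrow> ('q \<Rightarrow> real) \<Rightarrow> 'q \<Rightarrow> real^'q \<Rightarrow> (real^'q) set" where
  "Ghat T1 T2 i \<tau> = {c. T1 i \<le> c$i \<and> c$i \<le> T2 i \<and> (\<forall>k. k \<noteq> i \<longrightarrow> c$k = \<tau>$k)}"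

definition Gcl :: "('n \<Rightarrow> 'q::finite) \<Rightarrow> ('q \<Rightarrow> real) \<Rightarrow> ('q \<Rightarrow> real) \<Rightarrow>
    (real^'n) \<times> (real^'n) \<times> (real^'q) \<Rightarrow> ((real^'n) \<times> (real^'n) \<times> (real^'q)) set" where
  "Gcl blk T1 T2 = (\<lambda>(xp, \<eta>, \<tau>).
     \<Union>i\<in>{i. \<tau> \<in> Dset T2 i}. (\<lambda>c. (xp, hmap blk i \<eta>, c)) ` Ghat T1 T2 i \<tau>)"

definition Aset :: "('q::finite \<Rightarrow> real) \<Rightarrow> ((real^'n) \<times> (real^'n) \<times> (real^'q)) set" where
  "Aset T2 = {0} \<times> {0} \<times> Tset T2"

definition He :: "real^'n^'n \<Rightarrow> real^'n^'n" where
  "He M = M + transpose M"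

text \<open>Symmetric 3x3 block matrix [M11 M12 M13; * M22 M23; * * M33], as the
  linear map it induces on the product space.\<close>
definition block3 :: "real^'a^'a \<Rightarrow> real^'b^'a \<Rightarrow> real^'c^'a \<Rightarrow> real^'b^'b \<Rightarrow> real^'c^'b \<Rightarrow> real^'c^'c \<Rightarrow>
    (real^'a) \<times> (real^'b) \<times> (real^'c) \<Rightarrow> (real^'a) \<times> (real^'b) \<times> (real^'c)" where
  "block3 M11 M12 M13 M22 M23 M33 = (\<lambda>(x1, x2, x3).
     (M11 *v x1 + M12 *v x2 + M13 *v x3,
      transpose M12 *v x1 + M22 *v x2 + M23 *v x3,
      transpose M13 *v x1 + transpose M23 *v x2 + M33 *v x3))"

definition sym_op :: "('v::real_inner \<Rightarrow> 'v) \<Rightarrow> bool" where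
  "sym_op M \<longleftrightarrow> (\<forall>x y. inner (M x) y = inner x (M y))"

definition psd_op :: "('v::real_inner \<Rightarrow> 'v) \<Rightarrow> bool" where
  "psd_op M \<longleftrightarrow> sym_op M \<and> (\<forall>x. 0 \<le> inner x (M x))"

definition nd_op :: "('v::real_inner \<Rightarrow> 'v) \<Rightarrow> bool" where
  "nd_op M \<longleftrightarrow> sym_op M \<and> (\<forall>x. x \<noteq> 0 \<longrightarrow> inner x (M x) < 0)"

text \<open>Rb is the block-diagonal matrix R_1 (+) ... (+) R_q.  R(tau) and Sigma:\<close>
definition Rtau :: "('n \<Rightarrow> 'q::finite) \<Rightarrow> ('q \<Rightarrow> real) \<Rightarrow> real^'n^'n \<Rightarrow> real^'q \<Rightarrow> real^'n^'n" where
  "Rtau blk \<sigma> Rb \<tau> = (\<chi> k l. exp (\<sigma> (blk k) * \<tau>$(blk k)) * Rb$k$l)"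

definition Sig :: "('n \<Rightarrow> 'q::finite) \<Rightarrow> ('q \<Rightarrow> real) \<Rightarrow> real^'n^'n" where
  "Sig blk \<sigma> = (\<chi> k l. if k = l then \<sigma> (blk k) else 0)"

definition Mtau :: "real^'n^'n \<Rightarrow> real^'m^'n \<Rightarrow> real^'n^'m \<Rightarrow> real^'n^'n \<Rightarrow> real^'n^'m \<Rightarrow> real^'n^'m \<Rightarrow>
    real^'m^'m \<Rightarrow> ('n \<Rightarrow> 'q::finite) \<Rightarrow> ('q \<Rightarrow> real) \<Rightarrow> real^'n^'n \<Rightarrow> real^'q \<Rightarrow>
    (real^'n) \<times> (real^'n) \<times> (real^'m) \<Rightarrow> (real^'n) \<times> (real^'n) \<times> (real^'m)" where
  "Mtau A B K W Z J S blk \<sigma> Rb \<tau> =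
     block3 (He ((A + B ** K) ** W)) (- (B ** K)) (B ** S - W ** transpose K - transpose Z)
            (He (Rtau blk \<sigma> Rb \<tau> ** A) - Sig blk \<sigma> ** Rtau blk \<sigma> Rb \<tau>) (transpose K - transpose J)
            (- (2 *\<^sub>R S))"

definition LMI1 :: "real^'n^'n \<Rightarrow> real^'n^'n \<Rightarrow> real^'n^'m \<Rightarrow> real^'n^'m \<Rightarrow> real^'m \<Rightarrow> real \<Rightarrow> 'm \<Rightarrow>
    (real^'n) \<times> (real^'n) \<times> (real^1) \<Rightarrow> (real^'n) \<times> (real^'n) \<times> (real^1)" where
  "LMI1 W Rb Z J ub \<mu> i =
     block3 W 0 ((\<chi> k l. Z$i$k) :: real^1^'n) Rb ((\<chi> k l. J$i$k) :: real^1^'n)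
            (mat ((ub$i)^2 / \<mu>))"

definition Qset :: "('q::finite \<Rightarrow> real) \<Rightarrow> real^'n^'n \<Rightarrow> ('n \<Rightarrow> 'q) \<Rightarrow> ('q \<Rightarrow> real) \<Rightarrow> real^'n^'n \<Rightarrow> real \<Rightarrow>
    ((real^'n) \<times> (real^'n) \<times> (real^'q)) set" where
  "Qset T2 W blk \<sigma> Rb \<mu> = {(xp, \<eta>, \<tau>). (xp, \<eta>, \<tau>) \<in> Ccl T2 \<and>
      inner xp (matrix_inv W *v xp) + inner \<eta> (Rtau blk \<sigma> Rb \<tau> *v \<eta>) \<le> \<mu>}"

end

theory Submission
  imports Defs
begin

text \<open>
  The function \<open>V (x\<^sub>p, \<eta>, \<tau>) = x\<^sub>p \<bullet> W\<inverse> x\<^sub>p + \<eta> \<bullet> R(\<tau>) \<eta>\<close> is a Lyapunov function on the sublevel set \<open>V \<le> \<mu>\<close>.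
  Put \<open>p = W\<inverse> x\<^sub>p\<close> and \<open>\<xi> = S\<inverse> dz(K x\<^sub>p - K \<eta>)\<close>.  The first matrix inequality bounds every component of
  \<open>Z p + J \<eta>\<close> by the saturation level, so the sector property of the deadzone applies with reference
  \<open>- (Z p + J \<eta>)\<close>; adding it, the derivative of \<open>V\<close> along the flow is at most the quadratic form of the
  second matrix inequality at \<open>(p, \<eta>, \<xi>)\<close>, which by compactness is at most \<open>- c V\<close> for some \<open>c > 0\<close>.  A jump resets a
  block of \<open>\<eta>\<close> to zero, which cannot increase \<open>V\<close>.  Hence \<open>V\<close> decays exponentially in the ordinary time
  \<open>t\<close>.  The number of jumps is at most affine in \<open>t\<close>, which turns this into decay in \<open>t + j\<close>.
  Completeness of maximal solutions follows from boundedness and the Picard-Lindeloef theorem.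
\<close>

section \<open>Differential equations with a Lipschitz right-hand side\<close>

text \<open>The decay rate of \<open>V\<close> is available only where \<open>V \<le> \<mu>\<close>,
  since the bound by the saturation level comes from the first matrix inequality on that set.
  Invariance of the sublevel set and decay on it must therefore be proved together, which
  \<open>decay_below_level\<close> does on each stretch of flow. The weights exp(\<sigma>\<tau>)
  inside \<open>R\<close> reconcile flow and jumps: the timers run down at unit rate, so
  differentiating the weights along the flow produces the term with \<open>Sig\<close> in the second
  inequality, a loss that can offset the growth of \<eta> under \<open>A\<close>. When a timer is
  reset its weight leaps up, but by then it multiplies a block that is zero. Passing from the state
  to p undoes the inverse in \<open>V\<close>, so that the second inequality can be stated with
  \<open>W\<close> itself. For completeness the point is that a solution can leave the flow set only
  when some timer expires, and exactly there a jump is available.\<close>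

lemma ode_integral_eq:
  fixes u :: "real \<Rightarrow> 's::banach"
  assumes cont: "continuous_on {a..b} u"
    and der: "\<And>t. t \<in> {a<..<b} \<Longrightarrow> (u has_vector_derivative f (u t)) (at t)"
    and t: "t \<in> {a..b}"
  shows "u t = u a + integral {a..t} (\<lambda>s. f (u s))"
proof -
  have "((\<lambda>s. f (u s)) has_integral (u t - u a)) {a..t}"
  proof (rule fundamental_theorem_of_calculus_interior)
    show "continuous_on {a..t} u"
      using cont by (rule continuous_on_subset) (use t in auto)
  qed (use t der in auto)
  then show ?thesis
    by (simp add: integral_unique)
qed

text \<open>The integral form is the bridge to endpoints: a hybrid solution satisfies the equation
  only in the interior of a slice, whereas its integral equation holds up to the ends and returns
  one-sided derivatives there. It also makes the gluing of two pieces a matter of adding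
  integrals.\<close>

lemma integral_eq_imp_ode:
  fixes u :: "real \<Rightarrow> 's::banach"
  assumes cont: "continuous_on {a..b} u" and f: "continuous_on UNIV f"
    and eq: "\<And>t. t \<in> {a..b} \<Longrightarrow> u t = x + integral {a..t} (\<lambda>s. f (u s))"
    and t: "t \<in> {a..b}"
  shows "(u has_vector_derivative f (u t)) (at t within {a..b})"
proof -
  have c: "continuous_on {a..b} (\<lambda>s. f (u s))"
    using continuous_on_compose2[OF f cont] by auto
  have "((\<lambda>t. x + integral {a..t} (\<lambda>s. f (u s))) has_vector_derivative 0 + f (u t)) (at t within {a..b})"
    by (intro has_vector_derivative_add has_vector_derivative_const
        integral_has_vector_derivative[OF c t])
  then have "((\<lambda>t. x + integral {a..t} (\<lambda>s. f (u s))) has_vector_derivative f (u t)) (at t within {a..b})"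
    by simp
  then show ?thesis
    by (rule has_vector_derivative_transform[OF t, rotated]) (use eq in auto)
qed

text \<open>Banach's fixed point theorem for the integral operator, on the complete space of bounded
  continuous functions on the whole line.\<close>

lemma picard_local_existence:
  fixes f :: "'s::banach \<Rightarrow> 's" and a :: real
  assumes lip: "L-lipschitz_on UNIV f"
  obtains h u where "h > 0" "continuous_on {a..a+h} u"
    "\<And>t. t \<in> {a..a+h} \<Longrightarrow> u t = x + integral {a..t} (\<lambda>s. f (u s))"
proof -
  have L: "L \<ge> 0"
    using lip by (rule lipschitz_on_nonneg)
  \<comment> \<open>Chosen so that \<open>L * h \<le> 1/2\<close>, the contraction factor; the
    \<open>+ 1\<close> covers \<open>L = 0\<close>.\<close>
  define h where "h = 1 / (2 * (L + 1))"
  have h: "h > 0" "L * h \<le> 1/2"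
    using L by (auto simp: h_def field_simps)
  \<comment> \<open>Clamping time to the interval freezes the integral outside it, so the operator
    yields a bounded continuous function on all reals without restricting the domain.\<close>
  define r where "r t = max a (min (a + h) t)" for t
  have r: "r t \<in> {a..a+h}" for t
    using h by (auto simp: r_def)
  have contr: "continuous_on UNIV r"
    unfolding r_def by (intro continuous_intros)
  have contf: "continuous_on UNIV f"
    using lip by (rule lipschitz_on_continuous_on)
  have contfu: "continuous_on X (\<lambda>s. f (apply_bcontfun u s))" for u :: "real \<Rightarrow>\<^sub>C 's" and X
    using continuous_on_compose2[OF contf, of X "apply_bcontfun u"] by auto
  have intfu: "(\<lambda>s. f (apply_bcontfun u s)) integrable_on {b..c}" for u :: "real \<Rightarrow>\<^sub>C 's" and b c
    by (intro integrable_continuous_real contfu)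
  define P where "P u t = x + integral {a..r t} (\<lambda>s. f (apply_bcontfun u s))"
    for u :: "real \<Rightarrow>\<^sub>C 's" and t
  have P: "P u \<in> bcontfun" for u
  proof -
    have c: "continuous_on {a..a+h} (\<lambda>t. x + integral {a..t} (\<lambda>s. f (apply_bcontfun u s)))"
      by (intro continuous_intros indefinite_integral_continuous_1 intfu)
    have "continuous_on UNIV (P u)"
      unfolding P_def by (rule continuous_on_compose2[OF c contr]) (use r in blast)
    moreover have "bounded (range (P u))"
    proof (rule bounded_subset)
      show "bounded ((\<lambda>t. x + integral {a..t} (\<lambda>s. f (apply_bcontfun u s))) ` {a..a+h})"
        by (intro compact_imp_bounded compact_continuous_image[OF c]) simp
      show "range (P u) \<subseteq> (\<lambda>t. x + integral {a..t} (\<lambda>s. f (apply_bcontfun u s))) ` {a..a+h}"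
        using r by (auto simp: P_def)
    qed
    ultimately show ?thesis
      by (simp add: bcontfun_def)
  qed
  have "dist (Bcontfun (P u)) (Bcontfun (P v)) \<le> 1/2 * dist u v" for u v
  proof (rule dist_bound)
    fix t
    have "P u t - P v t = integral {a..r t} (\<lambda>s. f (apply_bcontfun u s) - f (apply_bcontfun v s))"
      by (simp add: P_def integral_diff intfu)
    moreover have "norm (integral {a..r t} (\<lambda>s. f (apply_bcontfun u s) - f (apply_bcontfun v s)))
        \<le> L * dist u v * (r t - a)"
    proof (rule integral_bound)
      show "a \<le> r t"
        using r[of t] by auto
      show "continuous_on {a..r t} (\<lambda>s. f (apply_bcontfun u s) - f (apply_bcontfun v s))"
        by (intro continuous_intros contfu)
      fix s
      have "norm (f (apply_bcontfun u s) - f (apply_bcontfun v s))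
          \<le> L * dist (apply_bcontfun u s) (apply_bcontfun v s)"
        using lipschitz_onD[OF lip] by (simp add: dist_norm)
      also have "\<dots> \<le> L * dist u v"
        by (intro mult_left_mono dist_bounded L)
      finally show "norm (f (apply_bcontfun u s) - f (apply_bcontfun v s)) \<le> L * dist u v" .
    qed
    moreover have "L * dist u v * (r t - a) \<le> 1/2 * dist u v"
    proof -
      have "L * (r t - a) \<le> L * h"
        using r[of t] L by (intro mult_left_mono) auto
      then have "L * (r t - a) \<le> 1/2"
        using h by linarith
      then show ?thesis
        using mult_right_mono[of "L * (r t - a)" "1/2" "dist u v"] by (simp add: mult_ac)
    qed
    ultimately show "dist (apply_bcontfun (Bcontfun (P u)) t) (apply_bcontfun (Bcontfun (P v)) t)
        \<le> 1/2 * dist u v"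
      by (simp add: Bcontfun_inverse P dist_norm)
  qed
  then obtain u where "Bcontfun (P u) = u"
    using banach_fix_type[of "1/2" "\<lambda>u. Bcontfun (P u)"] by auto
  then have u: "apply_bcontfun u = P u"
    by (metis Bcontfun_inverse P)
  show ?thesis
  proof (rule that[of h "apply_bcontfun u"])
    fix t
    assume "t \<in> {a..a+h}"
    then have "r t = t"
      by (auto simp: r_def)
    then have "P u t = x + integral {a..t} (\<lambda>s. f (apply_bcontfun u s))"
      by (simp add: P_def)
    then show "apply_bcontfun u t = x + integral {a..t} (\<lambda>s. f (apply_bcontfun u s))"
      using u by metis
  qed (use h in auto)
qed

text \<open>The rate is known only below the level, so crossing it must be excluded first. If
  \<open>v\<close> exceeded \<mu> at \<open>s\<close>, take the last earlier time \<open>y\<close>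
  with \<open>v y \<le> \<mu>\<close>. By continuity from the right \<open>v y = \<mu>\<close>,
  which is positive, so the derivative there is negative and \<open>v\<close> drops below \<mu> just
  after \<open>y\<close>, against the choice of \<open>y\<close>. Once the level is never crossed,
  the integrating factor exp(c s) gives the estimate.\<close>

lemma decay_below_level:
  fixes v :: "real \<Rightarrow> real"
  assumes der: "\<And>t. t \<in> {a..b} \<Longrightarrow> (v has_real_derivative v' t) (at t within {a..b})"
    and dec: "\<And>t. t \<in> {a..b} \<Longrightarrow> v t \<le> \<mu> \<Longrightarrow> v' t \<le> - c * v t"
    and c: "c > 0" and \<mu>: "\<mu> > 0" and va: "v a \<le> \<mu>" and t: "t \<in> {a..b}"
  shows "v t \<le> v a * exp (- c * (t - a))"
proof -
  have cont: "continuous_on {a..b} v"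
    using der by (rule DERIV_continuous_on)
  have below: "v s \<le> \<mu>" if s: "s \<in> {a..b}" for s
  proof (rule ccontr)
    assume "\<not> v s \<le> \<mu>"
    define Y where "Y = {a..s} \<inter> v -` {..\<mu>}"
    have conts: "continuous_on {a..s} v"
      using cont by (rule continuous_on_subset) (use s in auto)
    have "closed Y"
      unfolding Y_def by (intro continuous_closed_preimage conts) auto
    moreover have "a \<in> Y" "bdd_above Y"
      using va s by (auto simp: Y_def intro!: bdd_aboveI[of _ s])
    ultimately have "Sup Y \<in> Y" and ub: "\<And>x. x \<in> Y \<Longrightarrow> x \<le> Sup Y"
      by (auto intro: closed_contains_Sup cSup_upper)
    define y where "y = Sup Y"
    have y: "y \<in> {a..s}" "v y \<le> \<mu>"
      using \<open>Sup Y \<in> Y\<close> by (auto simp: Y_def y_def)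
    have above: "v x > \<mu>" if "y < x" "x \<le> s" for x
      using ub[of x] that y by (force simp: Y_def y_def)
    have "y < s"
      using y \<open>\<not> v s \<le> \<mu>\<close> by (cases "y = s") auto
    have ys: "y \<in> {a..b}"
      using y s by auto
    have "\<mu> \<le> v y"
    proof (rule tendsto_lowerbound)
      show "(v \<longlongrightarrow> v y) (at y within {y<..s})"
      proof (rule tendsto_within_subset)
        show "(v \<longlongrightarrow> v y) (at y within {a..b})"
          using cont ys unfolding continuous_on_def by blast
      qed (use ys s in auto)
      show "\<forall>\<^sub>F x in at y within {y<..s}. \<mu> \<le> v x"
        by (auto simp: eventually_at_filter less_imp_le above)
      show "at y within {y<..s} \<noteq> bot"
        using \<open>y < s\<close> by (simp add: at_within_eq_bot_iff)
    qed
    then have "v y = \<mu>"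
      using y by simp
    then have "v' y < 0"
      using dec[OF ys] c \<mu> by (smt (verit) mult_neg_pos)
    from has_real_derivative_neg_dec_right[OF der[OF ys] this]
    obtain d where d: "d > 0" "\<And>h. h > 0 \<Longrightarrow> y + h \<in> {a..b} \<Longrightarrow> h < d \<Longrightarrow> v (y + h) < v y"
      by blast
    define h where "h = min (d / 2) (s - y)"
    have "h > 0" "h < d" "y + h \<le> s"
      using d \<open>y < s\<close> by (auto simp: h_def min_def)
    then have "v (y + h) < v y" "v (y + h) > \<mu>"
      using d(2)[of h] above[of "y + h"] ys s by auto
    with y show False
      by linarith
  qed
  define g where "g s = v s * exp (c * s)" for s
  have "g t \<le> g a"
  proof (rule DERIV_nonpos_imp_decreasing_open[of a t g])
    show "continuous_on {a..t} g"
      unfolding g_def by (intro continuous_intros continuous_on_subset[OF cont]) (use t in auto)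
    fix s
    assume s: "a < s" "s < t"
    then have sb: "s \<in> {a<..<b}" "s \<in> {a..b}"
      using t by auto
    have "(v has_real_derivative v' s) (at s)"
      using der[OF sb(2)] sb(1) by (simp add: at_within_Icc_at)
    then have "(g has_real_derivative v' s * exp (c * s) + c * exp (c * s) * v s) (at s)"
      unfolding g_def by (auto intro!: derivative_eq_intros)
    moreover have "v' s * exp (c * s) + c * exp (c * s) * v s = (v' s + c * v s) * exp (c * s)"
      by (simp add: algebra_simps)
    moreover have "(v' s + c * v s) * exp (c * s) \<le> 0"
      using dec[OF sb(2) below[OF sb(2)]] by (intro mult_nonpos_nonneg) auto
    ultimately show "\<exists>y. (g has_real_derivative y) (at s) \<and> y \<le> 0"
      by metis
  qed (use t in auto)
  then have "v t * exp (c * t) * exp (- c * t) \<le> v a * exp (c * a) * exp (- c * t)"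
    unfolding g_def by (intro mult_right_mono) auto
  then show ?thesis
    by (simp add: mult.assoc exp_add[symmetric] algebra_simps)
qed

section \<open>Hybrid time domains and maximal solutions\<close>

lemma mem_slice [simp]: "t \<in> slice E j \<longleftrightarrow> (t, j) \<in> E"
  by (simp add: slice_def)

lemma slice_jump:
  assumes "hybrid_time_domain E" "(t, Suc j) \<in> E"
  shows "(Sup (slice E j), j) \<in> E" "(Sup (slice E j), Suc j) \<in> E" "Sup (slice E j) \<le> t"
    "\<And>s. (s, j) \<in> E \<Longrightarrow> s \<le> Sup (slice E j)"
proof -
  have *: "slice E j \<noteq> {}" "compact (slice E j)" "Sup (slice E j) \<in> slice E (Suc j)"
      "\<forall>t\<in>slice E (Suc j). Sup (slice E j) \<le> t"
    using assms by (force simp: hybrid_time_domain_def)+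
  then show "(Sup (slice E j), Suc j) \<in> E" "Sup (slice E j) \<le> t"
    using assms by auto
  have "Sup (slice E j) \<in> slice E j"
    using * by (intro closed_contains_Sup compact_imp_closed bounded_imp_bdd_above compact_imp_bounded)
  then show "(Sup (slice E j), j) \<in> E"
    by simp
  show "s \<le> Sup (slice E j)" if "(s, j) \<in> E" for s
    using * that by (intro cSup_upper bounded_imp_bdd_above compact_imp_bounded) auto
qed

lemma slice_nonneg: "hybrid_time_domain E \<Longrightarrow> (t, j) \<in> E \<Longrightarrow> 0 \<le> t"
  by (auto simp: hybrid_time_domain_def)

lemma slice_start:
  assumes "hybrid_time_domain E" "slice E j \<noteq> {}"
  obtains a where "(a, j) \<in> E" "\<And>t. (t, j) \<in> E \<Longrightarrow> a \<le> t"
proof (cases j)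
  case 0
  then show ?thesis
    using that[of 0] assms slice_nonneg by (auto simp: hybrid_time_domain_def)
next
  case (Suc i)
  from assms(2) obtain t where t: "(t, Suc i) \<in> E"
    using Suc by force
  show ?thesis
    using that[of "Sup (slice E i)"] slice_jump[OF assms(1)] t Suc by blast
qed

lemma slice_segment:
  assumes "hybrid_time_domain E" "(a, j) \<in> E" "(t, j) \<in> E"
  shows "{a..t} \<subseteq> slice E j"
proof -
  have "is_interval (slice E j)"
    using assms by (simp add: hybrid_time_domain_def)
  then show ?thesis
    using assms(2,3) mem_is_interval_1_I[of "slice E j" a t] by auto
qed

text \<open>Any point of the domain is reached from the origin by alternating stretches of flow and
  jumps, a jump out of slice \<open>j\<close> taking place at the supremum of that slice. This is
  the scheme for every invariant along solutions below.\<close>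

lemma hybrid_induct [consumes 2, case_names start flow jump]:
  assumes htd: "hybrid_time_domain E" and mem: "(t, j) \<in> E"
    and start: "P 0 0"
    and flow: "\<And>a t j. P a j \<Longrightarrow> a \<le> t \<Longrightarrow> (a, j) \<in> E \<Longrightarrow> (t, j) \<in> E \<Longrightarrow> P t j"
    and jump: "\<And>t j. P t j \<Longrightarrow> (t, j) \<in> E \<Longrightarrow> (t, Suc j) \<in> E \<Longrightarrow> P t (Suc j)"
  shows "P t j"
  using mem
proof (induction j arbitrary: t)
  case 0
  have "(0, 0) \<in> E"
    using htd by (simp add: hybrid_time_domain_def)
  then show ?case
    using flow[OF start] slice_nonneg[OF htd 0] 0 by simp
next
  case (Suc j)
  note * = slice_jump[OF htd Suc.prems]
  have "P (Sup (slice E j)) (Suc j)"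
    using Suc.IH *(1,2) jump by blast
  then show ?case
    using flow * Suc.prems by blast
qed

text \<open>Carries what a solution guarantees in the interior of a slice to closed segments: the
  equation by way of its integral form, membership in \<open>C\<close> by closedness and continuity.
  On a one-point segment the interior says nothing, and membership comes from the assumption at the
  left end.\<close>

lemma hybrid_solution_flow:
  fixes \<phi> :: "real \<times> nat \<Rightarrow> 's::banach"
  assumes sol: "hybrid_solution C f D G E \<phi>" and seg: "{a..b} \<subseteq> slice E j"
    and f: "continuous_on UNIV f"
  shows "continuous_on {a..b} (\<lambda>t. \<phi> (t, j))"
    and "t \<in> {a..b} \<Longrightarrow> \<phi> (t, j) = \<phi> (a, j) + integral {a..t} (\<lambda>s. f (\<phi> (s, j)))"
    and "t \<in> {a..b} \<Longrightarrow> ((\<lambda>t. \<phi> (t, j)) has_vector_derivative f (\<phi> (t, j))) (at t within {a..b})"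
    and "closed C \<Longrightarrow> \<phi> (a, j) \<in> C \<Longrightarrow> t \<in> {a..b} \<Longrightarrow> \<phi> (t, j) \<in> C"
proof -
  show c: "continuous_on {a..b} (\<lambda>t. \<phi> (t, j))"
    using sol seg by (auto simp: hybrid_solution_def intro: continuous_on_subset)
  have "{a<..<b} \<subseteq> interior (slice E j)"
    using seg by (meson greaterThanLessThan_subseteq_atLeastAtMost_iff interior_maximal
        open_greaterThanLessThan order_refl subset_trans)
  then have i: "\<phi> (t, j) \<in> C" "((\<lambda>s. \<phi> (s, j)) has_vector_derivative f (\<phi> (t, j))) (at t)"
    if "t \<in> {a<..<b}" for t
    using sol that by (auto simp: hybrid_solution_def)
  show eq: "\<phi> (t, j) = \<phi> (a, j) + integral {a..t} (\<lambda>s. f (\<phi> (s, j)))" if "t \<in> {a..b}" for t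
    by (rule ode_integral_eq[OF c _ that]) (rule i)
  show "((\<lambda>t. \<phi> (t, j)) has_vector_derivative f (\<phi> (t, j))) (at t within {a..b})" if "t \<in> {a..b}"
    by (rule integral_eq_imp_ode[OF c f eq that])
  show "\<phi> (t, j) \<in> C" if "closed C" "\<phi> (a, j) \<in> C" "t \<in> {a..b}"
  proof (cases "a < b")
    case True
    have "(\<lambda>t. \<phi> (t, j)) ` closure {a<..<b} \<subseteq> C"
      by (rule image_closure_subset) (use c i that True in auto)
    then show ?thesis
      using that True by auto
  next
    case False
    then have "t = a"
      using that by auto
    then show ?thesis
      using that by simp
  qed
qed

lemma hybrid_solution_in_flow_set:
  fixes \<phi> :: "real \<times> nat \<Rightarrow> 's::banach"
  assumes sol: "hybrid_solution C f D G E \<phi>" and f: "continuous_on UNIV f"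
    and C: "closed C" "D \<subseteq> C" "\<And>x. x \<in> D \<Longrightarrow> G x \<subseteq> C" and mem: "(t, j) \<in> E"
  shows "\<phi> (t, j) \<in> C"
proof -
  have htd: "hybrid_time_domain E"
    using sol by (simp add: hybrid_solution_def)
  from htd mem show ?thesis
  proof (induction rule: hybrid_induct)
    case start
    then show ?case
      using sol C by (auto simp: hybrid_solution_def)
  next
    case (flow a t j)
    then show ?case
      using hybrid_solution_flow(4)[OF sol slice_segment[OF htd flow(3,4)] f C(1)] by auto
  next
    case (jump t j)
    then show ?case
      using sol C(3) by (fastforce simp: hybrid_solution_def)
  qed
qed

text \<open>One statement for two uses: flowing on past a closed end of the last slice, and adding
  the missing right end of a half-open one. Because \<open>a\<close> stays the left end of the
  enlarged slice, its link to the preceding slice is untouched.\<close>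

lemma hybrid_solution_extend_flow:
  assumes sol: "hybrid_solution C f D G E \<phi>" and last: "slice E (Suc J) = {}"
    and a: "(a, J) \<in> E" and I: "is_interval I" "slice E J \<subseteq> I" "\<And>t. t \<in> I \<Longrightarrow> a \<le> t"
    and u: "continuous_on I u" "\<And>t. (t, J) \<in> E \<Longrightarrow> u t = \<phi> (t, J)"
      "\<And>t. t \<in> interior I \<Longrightarrow> u t \<in> C \<and> (u has_vector_derivative f (u t)) (at t)"
  shows "hybrid_solution C f D G (E \<union> I \<times> {J}) (\<lambda>(t, j). if j = J then u t else \<phi> (t, j))"
proof -
  have htd: "hybrid_time_domain E"
    using sol by (simp add: hybrid_solution_def)
  have sl: "slice (E \<union> I \<times> {J}) j = (if j = J then I else slice E j)" for j
    using I(2) by (auto simp: slice_def)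
  have a0: "0 \<le> a"
    using slice_nonneg[OF htd a] .
  have aJ: "a = Sup (slice E i)" if "J = Suc i" for i
  proof (rule antisym)
    show "a \<le> Sup (slice E i)"
      using slice_jump(2)[OF htd, of a i] a that I(2,3) by auto
    show "Sup (slice E i) \<le> a"
      using slice_jump(3)[OF htd, of a i] a that by auto
  qed
  have "hybrid_time_domain (E \<union> I \<times> {J})"
    unfolding hybrid_time_domain_def
  proof (intro conjI allI impI)
    show "E \<union> I \<times> {J} \<subseteq> {0..} \<times> UNIV" "(0, 0) \<in> E \<union> I \<times> {J}"
      using slice_nonneg[OF htd] htd order.trans[OF a0 I(3)] by (auto simp: hybrid_time_domain_def)
    fix j
    show "is_interval (slice (E \<union> I \<times> {J}) j)"
      using htd I(1) by (simp add: sl hybrid_time_domain_def)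
    assume ne: "slice (E \<union> I \<times> {J}) (Suc j) \<noteq> {}"
    then have j: "j \<noteq> J"
      using last by (auto simp: sl)
    have ne': "slice E (Suc j) \<noteq> {}"
      using ne a by (auto simp: sl split: if_splits)
    then have *: "slice E j \<noteq> {} \<and> compact (slice E j) \<and>
          Sup (slice E j) \<in> slice E (Suc j) \<and>
          (\<forall>t\<in>slice E (Suc j). Sup (slice E j) \<le> t)"
      using htd by (simp add: hybrid_time_domain_def)
    then show "slice (E \<union> I \<times> {J}) j \<noteq> {}" "compact (slice (E \<union> I \<times> {J}) j)"
      "Sup (slice (E \<union> I \<times> {J}) j) \<in> slice (E \<union> I \<times> {J}) (Suc j)"
      using j I(2) by (auto simp: sl)
    show "\<forall>t\<in>slice (E \<union> I \<times> {J}) (Suc j). Sup (slice (E \<union> I \<times> {J}) j) \<le> t"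
      using j * I(3) aJ by (auto simp: sl)
  qed
  moreover have "(0, 0) \<in> E"
    using htd by (simp add: hybrid_time_domain_def)
  then have "(\<lambda>(t, j). if j = J then u t else \<phi> (t, j)) (0, 0) \<in> closure C \<union> D"
    using sol u(2)[of 0] by (auto simp: hybrid_solution_def)
  moreover have "continuous_on (slice (E \<union> I \<times> {J}) j)
       (\<lambda>t. (\<lambda>(t, j). if j = J then u t else \<phi> (t, j)) (t, j)) \<and>
      (\<forall>t\<in>interior (slice (E \<union> I \<times> {J}) j).
        (\<lambda>(t, j). if j = J then u t else \<phi> (t, j)) (t, j) \<in> C \<and>
        ((\<lambda>s. (\<lambda>(t, j). if j = J then u t else \<phi> (t, j)) (s, j)) has_vector_derivative
          f ((\<lambda>(t, j). if j = J then u t else \<phi> (t, j)) (t, j))) (at t))" for j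
    using sol u by (cases "j = J") (auto simp: sl hybrid_solution_def)
  moreover have "(\<lambda>(t, j). if j = J then u t else \<phi> (t, j)) (t, j) \<in> D \<and>
      (\<lambda>(t, j). if j = J then u t else \<phi> (t, j)) (t, Suc j)
        \<in> G ((\<lambda>(t, j). if j = J then u t else \<phi> (t, j)) (t, j))"
    if "(t, j) \<in> E \<union> I \<times> {J}" "(t, Suc j) \<in> E \<union> I \<times> {J}" for t j
  proof -
    have j: "j \<noteq> J"
      using that(2) last by (force simp: slice_def)
    then have tj: "(t, j) \<in> E"
      using that by auto
    \<comment> \<open>The enlarged slice creates no new jump: a time shared with the preceding slice
      is at most the supremum of that slice, which is \<open>a\<close>, and at least
      \<open>a\<close>.\<close>
    have tSj: "(t, Suc j) \<in> E"
    proof (cases "Suc j = J")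
      case True
      then have "a \<le> t"
        using that(2) I by auto
      moreover have "t \<le> a"
        using slice_jump(4)[OF htd] a aJ True tj by blast
      ultimately show ?thesis
        using a True by simp
    qed (use that(2) in auto)
    then show ?thesis
      using sol tj j u(2) by (auto simp: hybrid_solution_def)
  qed
  ultimately show ?thesis
    unfolding hybrid_solution_def by blast
qed

text \<open>The added slice is the single point \<open>b\<close>. Its interior is empty, so it
  brings no flow condition.\<close>

lemma hybrid_solution_extend_jump:
  assumes sol: "hybrid_solution C f D G E \<phi>" and last: "slice E (Suc J) = {}"
    and sl: "slice E J = {a..b}" "a \<le> b" and D: "\<phi> (b, J) \<in> D" and g: "g \<in> G (\<phi> (b, J))"
  shows "hybrid_solution C f D G (insert (b, Suc J) E) (\<phi>((b, Suc J) := g))"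
proof -
  have htd: "hybrid_time_domain E"
    using sol by (simp add: hybrid_solution_def)
  have bJ: "(b, J) \<in> E"
    using sl by (metis atLeastAtMost_iff mem_slice order_refl)
  have emp: "slice E (Suc (Suc J)) = {}"
    using htd last by (auto simp: hybrid_time_domain_def)
  have sl': "slice (insert (b, Suc J) E) j = (if j = Suc J then {b} else slice E j)" for j
    using last by (auto simp: slice_def)
  have "hybrid_time_domain (insert (b, Suc J) E)"
    unfolding hybrid_time_domain_def
  proof (intro conjI allI impI)
    show "insert (b, Suc J) E \<subseteq> {0..} \<times> UNIV" "(0, 0) \<in> insert (b, Suc J) E"
      using htd bJ by (auto simp: hybrid_time_domain_def)
    fix j
    show "is_interval (slice (insert (b, Suc J) E) j)"
      using htd convex_singleton[of b] by (simp add: sl' hybrid_time_domain_def is_interval_convex_1)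
    assume ne: "slice (insert (b, Suc J) E) (Suc j) \<noteq> {}"
    then have j: "j \<noteq> Suc J"
      using emp by (auto simp: sl')
    have "slice (insert (b, Suc J) E) j \<noteq> {} \<and> compact (slice (insert (b, Suc J) E) j) \<and>
      Sup (slice (insert (b, Suc J) E) j) \<in> slice (insert (b, Suc J) E) (Suc j) \<and>
      (\<forall>t\<in>slice (insert (b, Suc J) E) (Suc j). Sup (slice (insert (b, Suc J) E) j) \<le> t)"
    proof (cases "j = J")
      case True
      then show ?thesis
        using sl by (simp add: sl')
    next
      case False
      then show ?thesis
        using ne j htd by (simp add: sl' hybrid_time_domain_def)
    qed
    then show "slice (insert (b, Suc J) E) j \<noteq> {}" "compact (slice (insert (b, Suc J) E) j)"
      "Sup (slice (insert (b, Suc J) E) j) \<in> slice (insert (b, Suc J) E) (Suc j)"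
      "\<forall>t\<in>slice (insert (b, Suc J) E) (Suc j). Sup (slice (insert (b, Suc J) E) j) \<le> t"
      by auto
  qed
  moreover have "(\<phi>((b, Suc J) := g)) (0, 0) \<in> closure C \<union> D"
    using sol by (auto simp: hybrid_solution_def)
  moreover have "continuous_on (slice (insert (b, Suc J) E) j) (\<lambda>t. (\<phi>((b, Suc J) := g)) (t, j)) \<and>
      (\<forall>t\<in>interior (slice (insert (b, Suc J) E) j). (\<phi>((b, Suc J) := g)) (t, j) \<in> C \<and>
        ((\<lambda>s. (\<phi>((b, Suc J) := g)) (s, j)) has_vector_derivative
          f ((\<phi>((b, Suc J) := g)) (t, j))) (at t))" for j
    using sol by (cases "j = Suc J") (auto simp: sl' hybrid_solution_def)
  moreover have "(\<phi>((b, Suc J) := g)) (t, j) \<in> D \<and>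
      (\<phi>((b, Suc J) := g)) (t, Suc j) \<in> G ((\<phi>((b, Suc J) := g)) (t, j))"
    if t: "(t, j) \<in> insert (b, Suc J) E" "(t, Suc j) \<in> insert (b, Suc J) E" for t j
  proof -
    have j: "j \<noteq> Suc J"
      using t(2) emp by (force simp: slice_def)
    then have tj: "(t, j) \<in> E"
      using t by auto
    show ?thesis
    proof (cases "j = J")
      case True
      then have "t = b"
        using t(2) last by (force simp: slice_def)
      then show ?thesis
        using True D g by simp
    next
      case False
      then show ?thesis
        using sol tj t j by (auto simp: hybrid_solution_def)
    qed
  qed
  ultimately show ?thesis
    unfolding hybrid_solution_def by blast
qed

lemma maximal_solution_not_extendable:
  assumes "maximal_solution C f D G E \<phi>" "hybrid_solution C f D G E' \<psi>" "E \<subseteq> E'"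
    "\<And>p. p \<in> E \<Longrightarrow> \<psi> p = \<phi> p"
  shows "E' = E"
  using assms unfolding maximal_solution_def by blast

text \<open>A bounded time domain has a last slice; depending on whether this slice is closed and where the
  solution ends, it could be prolonged by a jump, by a flow, or by its limit.\<close>
lemma maximal_solution_complete:
  fixes f :: "'s::banach \<Rightarrow> 's"
  assumes max: "maximal_solution C f D G E \<phi>" and lip: "L-lipschitz_on UNIV f"
    and C: "closed C" "D \<subseteq> C" "\<And>x. x \<in> D \<Longrightarrow> G x \<subseteq> C" "\<And>x. x \<in> D \<Longrightarrow> G x \<noteq> {}"
    and viable: "\<And>(u::real \<Rightarrow> 's) a h. \<lbrakk>u a \<in> C - D; h > 0;
        \<And>t. t \<in> {a..a+h} \<Longrightarrow> (u has_vector_derivative f (u t)) (at t within {a..a+h})\<rbrakk>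
      \<Longrightarrow> \<exists>k\<in>{0<..h}. \<forall>t\<in>{a..a+k}. u t \<in> C"
    and bd: "\<And>t j. (t, j) \<in> E \<Longrightarrow> norm (\<phi> (t, j)) \<le> M"
  shows "complete_domain E"
proof (rule ccontr)
  assume "\<not> complete_domain E"
  then obtain N where N: "\<And>t j. (t, j) \<in> E \<Longrightarrow> t + real j \<le> N"
    unfolding complete_domain_def by (force simp: not_less)
  have sol: "hybrid_solution C f D G E \<phi>"
    using max by (simp add: maximal_solution_def)
  have htd: "hybrid_time_domain E"
    using sol by (simp add: hybrid_solution_def)
  have contf: "continuous_on UNIV f"
    using lip by (rule lipschitz_on_continuous_on)
  have inC: "\<phi> (t, j) \<in> C" if "(t, j) \<in> E" for t j
    by (rule hybrid_solution_in_flow_set[OF sol contf C(1-3) that])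
  define js where "js = {j. slice E j \<noteq> {}}"
  have "j \<le> nat \<lceil>N\<rceil>" if j: "j \<in> js" for j
  proof -
    obtain t where "(t, j) \<in> E"
      using j by (auto simp: js_def slice_def)
    then have "real j \<le> N"
      using N[of t j] slice_nonneg[OF htd, of t j] by linarith
    then show ?thesis
      by linarith
  qed
  then have fin: "finite js"
    using finite_nat_set_iff_bounded_le by blast
  have "0 \<in> js"
    using htd by (auto simp: js_def hybrid_time_domain_def slice_def)
  define J where "J = Max js"
  have "J \<in> js"
    using fin \<open>0 \<in> js\<close> by (auto simp: J_def intro!: Max_in)
  have "Suc J \<notin> js"
    using Max_ge[OF fin, of "Suc J"] unfolding J_def by linarith
  then have last: "slice E (Suc J) = {}"
    by (simp add: js_def)
  have "slice E J \<noteq> {}"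
    using \<open>J \<in> js\<close> by (simp add: js_def)
  from slice_start[OF htd this]
  obtain a where a: "(a, J) \<in> E" "\<And>t. (t, J) \<in> E \<Longrightarrow> a \<le> t"
    by metis
  define b where "b = Sup (slice E J)"
  have bdd: "bdd_above (slice E J)"
  proof (rule bdd_aboveI)
    fix t
    assume "t \<in> slice E J"
    then show "t \<le> N"
      using N[of t J] by simp
  qed
  have le_b: "t \<le> b" if "(t, J) \<in> E" for t
    unfolding b_def by (rule cSup_upper[OF _ bdd]) (use that in simp)
  have below: "(t, J) \<in> E" if t: "a \<le> t" "t < b" for t
  proof -
    obtain s where "(s, J) \<in> E" "t < s"
      using t(2) less_cSup_iff[OF \<open>slice E J \<noteq> {}\<close> bdd, of t] unfolding b_def by auto
    then show ?thesis
      using slice_segment[OF htd a(1), of s, THEN subsetD, of t] t(1) by simp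
  qed
  have ab: "a \<le> b"
    using le_b a by blast
  show False
  proof (cases "(b, J) \<in> E")
    case True
    have sl: "slice E J = {a..b}"
      by (intro equalityI slice_segment[OF htd a(1) True]) (use a le_b in auto)
    show False
    proof (cases "\<phi> (b, J) \<in> D")
      case True
      then obtain g where "g \<in> G (\<phi> (b, J))"
        using C(4) by blast
      from hybrid_solution_extend_jump[OF sol last sl ab True this]
      have "insert (b, Suc J) E = E"
        by (rule maximal_solution_not_extendable[OF max]) (use last in \<open>auto simp: slice_def\<close>)
      then show False
        using last by (auto simp: slice_def)
    next
      case False
      obtain h w where h: "h > 0" and w: "continuous_on {b..b+h} w"
        and w_eq: "\<And>t. t \<in> {b..b+h} \<Longrightarrow> w t = \<phi> (b, J) + integral {b..t} (\<lambda>s. f (w s))"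
        using picard_local_existence[OF lip, where a = b and x = "\<phi> (b, J)"] by blast
      have wb: "w b = \<phi> (b, J)"
        using w_eq[of b] h by simp
      have "w b \<in> C - D"
        using wb False inC[OF True] by simp
      then have "\<exists>k\<in>{0<..h}. \<forall>t\<in>{b..b+k}. w t \<in> C"
        using h integral_eq_imp_ode[OF w contf w_eq] by (rule viable)
      then obtain k where k: "k \<in> {0<..h}" "\<And>t. t \<in> {b..b+k} \<Longrightarrow> w t \<in> C"
        by blast
      \<comment> \<open>The old arc is continued by the Picard solution \<open>w\<close> issuing
        from its end point. Differentiability at the junction \<open>b\<close> is not visible from
        the two pieces; it is read off from the integral equation \<open>u_eq\<close> of the glued
        arc.\<close>
      define u where "u t = (if t \<le> b then \<phi> (t, J) else w t)" for t
      have u1: "u t = \<phi> (t, J)" if "t \<le> b" for t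
        using that by (simp add: u_def)
      have u2: "u t = w t" if "b \<le> t" for t
        using that wb by (simp add: u_def)
      note flow = hybrid_solution_flow[OF sol, of a b J, unfolded sl, OF order_refl contf]
      have contu: "continuous_on {a..b+k} u"
      proof -
        have "continuous_on ({a..b} \<union> {b..b+k}) u"
        proof (rule continuous_on_closed_Un)
          show "continuous_on {a..b} u"
            using flow(1) by (rule continuous_on_eq) (auto simp: u1)
          have "continuous_on {b..b+k} w"
            using w by (rule continuous_on_subset) (use k in auto)
          then show "continuous_on {b..b+k} u"
            by (rule continuous_on_eq) (auto simp: u2)
        qed auto
        then show ?thesis
          using ab k by (simp add: ivl_disj_un)
      qed
      have contfu: "continuous_on {a..b+k} (\<lambda>s. f (u s))"
        using continuous_on_compose2[OF contf contu] by auto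
      have u_eq: "u t = \<phi> (a, J) + integral {a..t} (\<lambda>s. f (u s))" if t: "t \<in> {a..b+k}" for t
      proof (cases "t \<le> b")
        case True
        have "integral {a..t} (\<lambda>s. f (u s)) = integral {a..t} (\<lambda>s. f (\<phi> (s, J)))"
          by (rule integral_cong) (use True in \<open>auto simp: u1\<close>)
        then show ?thesis
          using flow(2)[of t] True t u1 by simp
      next
        case False
        have "integral {a..b} (\<lambda>s. f (u s)) = integral {a..b} (\<lambda>s. f (\<phi> (s, J)))"
          by (rule integral_cong) (auto simp: u1)
        moreover have "integral {b..t} (\<lambda>s. f (u s)) = integral {b..t} (\<lambda>s. f (w s))"
          by (rule integral_cong) (auto simp: u2)
        moreover have "integral {a..b} (\<lambda>s. f (u s)) + integral {b..t} (\<lambda>s. f (u s))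
            = integral {a..t} (\<lambda>s. f (u s))"
        proof (rule Henstock_Kurzweil_Integration.integral_combine)
          show "(\<lambda>s. f (u s)) integrable_on {a..t}"
            by (intro integrable_continuous_real continuous_on_subset[OF contfu]) (use t in auto)
        qed (use ab False in auto)
        ultimately show ?thesis
          using flow(2)[of b] w_eq[of t] u2[of t] False t k ab by (simp add: add.assoc[symmetric])
      qed
      have "hybrid_solution C f D G (E \<union> {a..b+k} \<times> {J}) (\<lambda>(t, j). if j = J then u t else \<phi> (t, j))"
      proof (rule hybrid_solution_extend_flow[OF sol last a(1) _ _ _ contu])
        fix t
        assume "t \<in> interior {a..b+k}"
        then have t: "t \<in> {a<..<b+k}"
          by simp
        have "u t \<in> C"
        proof (cases "t \<le> b")
          case True
          then have "t \<in> slice E J"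
            using t sl by auto
          then show ?thesis
            using inC True by (simp add: u_def)
        next
          case False
          then show ?thesis
            using k(2)[of t] t by (simp add: u_def)
        qed
        moreover have "(u has_vector_derivative f (u t)) (at t within {a..b+k})"
          by (rule integral_eq_imp_ode[OF contu contf u_eq]) (use t in auto)
        then have "(u has_vector_derivative f (u t)) (at t)"
          using t by (simp add: at_within_Icc_at)
        ultimately show "u t \<in> C \<and> (u has_vector_derivative f (u t)) (at t)"
          by simp
      next
        show "slice E J \<subseteq> {a..b+k}"
          unfolding sl using k by auto
      qed (use u1 le_b in \<open>auto simp: is_interval_cc\<close>)
      then have "E \<union> {a..b+k} \<times> {J} = E"
        by (rule maximal_solution_not_extendable[OF max]) (auto simp: u1 le_b)
      moreover have "(b + k, J) \<in> E \<union> {a..b+k} \<times> {J}"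
        using ab k by simp
      ultimately show False
        using le_b[of "b + k"] k by simp
    qed
  next
    case False
    then have "a < b"
      using a ab by (cases "a = b") auto
    have sl: "slice E J = {a..<b}"
    proof -
      have "t < b" if "(t, J) \<in> E" for t
        using le_b[OF that] that False by (cases "t = b") auto
      then show ?thesis
        using a(2) below by auto
    qed
    \<comment> \<open>A bound on the speed along the bounded arc: it makes the arc Lipschitz in
      time, hence continuously extendable to the missing end \<open>b\<close>.\<close>
    define B where "B = norm (f 0) + L * M"
    have L: "L \<ge> 0"
      using lip by (rule lipschitz_on_nonneg)
    have fB: "norm (f (\<phi> (t, J))) \<le> B" if "(t, J) \<in> E" for t
    proof -
      have "norm (f (\<phi> (t, J))) \<le> norm (f 0) + norm (f (\<phi> (t, J)) - f 0)"
        by (metis add.commute diff_add_cancel norm_triangle_ineq)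
      also have "norm (f (\<phi> (t, J)) - f 0) \<le> L * norm (\<phi> (t, J))"
        using lipschitz_on_normD[OF lip, of "\<phi> (t, J)" 0] by simp
      also have "\<dots> \<le> L * M"
        using bd[OF that] L by (rule mult_left_mono)
      finally show ?thesis
        by (simp add: B_def)
    qed
    have "B-lipschitz_on {a..<b} (\<lambda>t. \<phi> (t, J))"
    proof (rule lipschitz_on_leI)
      show "B \<ge> 0"
        using fB[OF a(1)] norm_ge_zero order_trans by blast
      fix s t
      assume st: "s \<in> {a..<b}" "t \<in> {a..<b}" "s \<le> t"
      have seg: "{s..t} \<subseteq> slice E J"
        unfolding sl using st by auto
      note flow = hybrid_solution_flow[OF sol seg contf]
      have "dist (\<phi> (s, J)) (\<phi> (t, J)) = norm (integral {s..t} (\<lambda>r. f (\<phi> (r, J))))"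
        using flow(2)[of t] st by (simp add: dist_norm norm_minus_commute)
      also have "\<dots> \<le> B * (t - s)"
      proof (rule integral_bound)
        show "continuous_on {s..t} (\<lambda>r. f (\<phi> (r, J)))"
          using continuous_on_compose2[OF contf flow(1)] by auto
        show "norm (f (\<phi> (r, J))) \<le> B" if "r \<in> {s..t}" for r
          using fB subsetD[OF seg that] by simp
      qed (rule st(3))
      finally show "dist (\<phi> (s, J)) (\<phi> (t, J)) \<le> B * dist s t"
        using st by (simp add: dist_real_def)
    qed
    then obtain g where g: "B-lipschitz_on (closure {a..<b}) g" "\<And>t. t \<in> {a..<b} \<Longrightarrow> g t = \<phi> (t, J)"
      using lipschitz_extend_closure by blast
    have contg: "continuous_on {a..b} g"
      using lipschitz_on_continuous_on[OF g(1)] \<open>a < b\<close> by simp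
    have gJ: "g t = \<phi> (t, J)" if "(t, J) \<in> E" for t
      using g(2)[of t] that sl mem_slice by blast
    have "hybrid_solution C f D G (E \<union> {a..b} \<times> {J}) (\<lambda>(t, j). if j = J then g t else \<phi> (t, j))"
    proof (rule hybrid_solution_extend_flow[OF sol last a(1) _ _ _ contg])
      fix t
      assume "t \<in> interior {a..b}"
      then have t: "t \<in> {a<..<b}"
        by simp
      have "interior (slice E J) = {a<..<b}"
        by (simp add: sl)
      then have "\<phi> (t, J) \<in> C" "((\<lambda>s. \<phi> (s, J)) has_vector_derivative f (\<phi> (t, J))) (at t)"
        using sol t by (auto simp: hybrid_solution_def)
      moreover from this(2) have "(g has_vector_derivative f (\<phi> (t, J))) (at t)"
        by (rule has_vector_derivative_transform_within_open[OF _ _ t]) (use g(2) in auto)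
      ultimately show "g t \<in> C \<and> (g has_vector_derivative f (g t)) (at t)"
        using g(2)[of t] t by simp
    next
      show "slice E J \<subseteq> {a..b}"
        unfolding sl by auto
    qed (use gJ in \<open>auto simp: is_interval_cc\<close>)
    then have "E \<union> {a..b} \<times> {J} = E"
      by (rule maximal_solution_not_extendable[OF max]) (auto simp: gJ)
    moreover have "(b, J) \<in> E \<union> {a..b} \<times> {J}"
      using ab by simp
    ultimately show False
      using False by simp
  qed
qed

section \<open>Quadratic forms and linear matrix inequalities\<close>

lemma inner_vector_matrix:
  fixes M :: "real^'a::finite^'b::finite"
  shows "inner y (x v* M) = inner x (M *v y)"
  by (metis dot_lmul_matrix inner_commute)

lemma inner_symmetric_matrix:
  fixes M :: "real^'a::finite^'a"
  assumes "transpose M = M"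
  shows "inner x (M *v y) = inner y (M *v x)"
  by (metis assms inner_vector_matrix transpose_matrix_vector)

lemma inner_He: "inner x (He M *v x) = 2 * inner x (M *v x)"
  by (simp add: He_def matrix_vector_mult_add_rdistrib inner_add_right inner_vector_matrix)

lemma inner_block3:
  fixes M11 :: "real^'a::finite^'a" and M22 :: "real^'b::finite^'b" and M33 :: "real^'c::finite^'c"
  shows "inner (x, y, z) (block3 M11 M12 M13 M22 M23 M33 (x, y, z)) =
    inner x (M11 *v x) + inner y (M22 *v y) + inner z (M33 *v z)
    + 2 * inner x (M12 *v y) + 2 * inner x (M13 *v z) + 2 * inner y (M23 *v z)"
  by (simp add: block3_def inner_add_right inner_vector_matrix)

text \<open>The minimum over the compact product of \<open>T\<close> and the unit sphere is attained
  and positive; homogeneity carries it to all vectors. Keeping the parameter inside the compact set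
  is what makes the constant uniform in \<tau>.\<close>

lemma quadratic_form_coercive:
  fixes g :: "'p::metric_space \<Rightarrow> 'a::euclidean_space \<Rightarrow> real"
  assumes T: "compact T" and cont: "continuous_on (T \<times> UNIV) (\<lambda>(\<tau>, v). g \<tau> v)"
    and hom: "\<And>\<tau> r v. g \<tau> (r *\<^sub>R v) = r\<^sup>2 * g \<tau> v"
    and pos: "\<And>\<tau> v. \<tau> \<in> T \<Longrightarrow> v \<noteq> 0 \<Longrightarrow> g \<tau> v > 0"
  obtains c where "c > 0" "\<And>\<tau> v. \<tau> \<in> T \<Longrightarrow> c * (norm v)\<^sup>2 \<le> g \<tau> v"
proof (cases "T = {}")
  case False
  have "compact (T \<times> sphere 0 1 :: ('p \<times> 'a) set)"
    by (intro compact_Times T compact_sphere)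
  moreover have "T \<times> (sphere 0 1 :: 'a set) \<noteq> {}"
    using False by simp
  moreover have "continuous_on (T \<times> sphere 0 1) (\<lambda>(\<tau>, v). g \<tau> v)"
    using cont by (rule continuous_on_subset) auto
  ultimately obtain \<tau>0 v0 where m: "\<tau>0 \<in> T" "v0 \<in> sphere 0 1"
    "\<And>\<tau> v. \<tau> \<in> T \<Longrightarrow> v \<in> sphere 0 1 \<Longrightarrow> g \<tau>0 v0 \<le> g \<tau> v"
    using continuous_attains_inf[of "T \<times> sphere 0 1" "\<lambda>(\<tau>, v). g \<tau> v"] by fastforce
  show ?thesis
  proof (rule that)
    show "g \<tau>0 v0 > 0"
      using m by (intro pos) auto
    fix \<tau> and v :: 'a
    assume \<tau>: "\<tau> \<in> T"
    show "g \<tau>0 v0 * (norm v)\<^sup>2 \<le> g \<tau> v"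
    proof (cases "v = 0")
      case True
      then show ?thesis
        using hom[of \<tau> 0 v] by simp
    next
      case False
      have "g \<tau>0 v0 * (norm v)\<^sup>2 \<le> g \<tau> (v /\<^sub>R norm v) * (norm v)\<^sup>2"
        by (intro mult_right_mono m(3)[OF \<tau>]) (use False in auto)
      also have "\<dots> = g \<tau> v"
        using hom[of \<tau> "norm v" "v /\<^sub>R norm v"] False by simp
      finally show ?thesis .
    qed
  qed
qed (use that[of 1] in simp)

lemma matrix_form_coercive:
  fixes M :: "real^'a::finite^'a"
  assumes "\<And>v. v \<noteq> 0 \<Longrightarrow> 0 < inner v (M *v v)"
  obtains c where "c > 0" "\<And>v. c * (norm v)\<^sup>2 \<le> inner v (M *v v)"
proof -
  obtain c where "c > 0" "\<And>(\<tau>::real) v. \<tau> \<in> {0} \<Longrightarrow> c * (norm v)\<^sup>2 \<le> inner v (M *v v)"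
  proof (rule quadratic_form_coercive[of "{0::real}" "\<lambda>_ v. inner v (M *v v)"])
    show "continuous_on ({0} \<times> UNIV) (\<lambda>(\<tau>::real, v). inner v (M *v v))"
      unfolding case_prod_unfold
      by (intro continuous_intros bounded_linear.continuous_on[OF matrix_vector_mul_bounded_linear])
  qed (use assms in \<open>auto simp: matrix_vector_mult_scaleR power2_eq_square\<close>)
  then show ?thesis
    using that by auto
qed

lemma matrix_form_bounded:
  fixes M :: "real^'a::finite^'a"
  obtains c where "c > 0" "\<And>v. inner v (M *v v) \<le> c * (norm v)\<^sup>2"
proof -
  obtain c where c: "c > 0" "\<And>v. norm (M *v v) \<le> norm v * c"
    using bounded_linear.pos_bounded[OF matrix_vector_mul_bounded_linear[of M]] by blast
  have "inner v (M *v v) \<le> c * (norm v)\<^sup>2" for v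
  proof -
    have "inner v (M *v v) \<le> norm v * norm (M *v v)"
      by (rule norm_cauchy_schwarz)
    also have "\<dots> \<le> norm v * (norm v * c)"
      by (intro mult_left_mono c) auto
    finally show ?thesis
      by (simp add: power2_eq_square mult_ac)
  qed
  then show ?thesis
    using that c(1) by blast
qed

text \<open>A definite form has trivial kernel, hence \<open>W\<close> is invertible, and the form
  of the inverse at \<open>x\<close> equals the form of \<open>W\<close> at
  \<open>matrix_inv W *v x\<close>.\<close>

lemma positive_definite_inverse:
  fixes W :: "real^'a::finite^'a"
  assumes "transpose W = W" "\<And>v. v \<noteq> 0 \<Longrightarrow> 0 < inner v (W *v v)"
  shows "W *v (matrix_inv W *v x) = x" "transpose (matrix_inv W) = matrix_inv W"
    "x \<noteq> 0 \<Longrightarrow> 0 < inner x (matrix_inv W *v x)"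
proof -
  have "\<exists>B. B ** W = mat 1"
    unfolding matrix_left_invertible_ker using assms(2) by (metis inner_zero_right less_irrefl)
  then have "\<exists>B. W ** B = mat 1 \<and> B ** W = mat 1"
    using matrix_left_right_inverse by blast
  then have inv: "W ** matrix_inv W = mat 1" "matrix_inv W ** W = mat 1"
    unfolding matrix_inv_def by (metis (mono_tags, lifting) someI_ex)+
  show W: "W *v (matrix_inv W *v x) = x" for x
    by (simp add: matrix_vector_mul_assoc inv)
  have "transpose (matrix_inv W) ** W = mat 1"
    by (metis assms(1) inv(1) matrix_transpose_mul transpose_mat)
  then show "transpose (matrix_inv W) = matrix_inv W"
    by (metis inv(1) matrix_mul_assoc matrix_mul_lid matrix_mul_rid)
  show "0 < inner x (matrix_inv W *v x)" if "x \<noteq> 0"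
  proof -
    have "matrix_inv W *v x \<noteq> 0"
      using W[of x] that by auto
    then show ?thesis
      using assms(2)[of "matrix_inv W *v x"] by (simp add: W inner_commute)
  qed
qed

section \<open>Saturation and deadzone\<close>

lemma sat_component: "0 < ub$i \<Longrightarrow> sat ub v $ i = max (- (ub$i)) (min (v$i) (ub$i))"
  by (auto simp: sat_def sgn_if min_def max_def)

text \<open>The deadzone is nonzero only where the saturation sits at one of its limits. There
  \<open>sat ub v $ i - y\<close> points towards that limit, as \<open>y\<close> lies within the
  range, while the deadzone points back inwards; the factors have opposite signs.\<close>

lemma deadzone_sector:
  assumes "0 < ub$i" "\<bar>y\<bar> \<le> ub$i"
  shows "dz ub v $ i * (dz ub v $ i + v$i - y) \<le> 0"
proof -
  have "dz ub v $ i + v$i = sat ub v $ i"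
    by (simp add: dz_def)
  moreover consider "v$i > ub$i" | "v$i < - (ub$i)" | "\<bar>v$i\<bar> \<le> ub$i"
    by linarith
  then have "dz ub v $ i * (sat ub v $ i - y) \<le> 0"
  proof cases
    case 1
    then show ?thesis
      using assms by (auto simp: dz_def sat_component min_def max_def intro!: mult_nonpos_nonneg)
  next
    case 2
    then show ?thesis
      using assms by (auto simp: dz_def sat_component min_def max_def intro!: mult_nonneg_nonpos)
  next
    case 3
    then show ?thesis
      using assms by (auto simp: dz_def sat_component min_def max_def)
  qed
  ultimately show ?thesis
    by simp
qed

text \<open>Each component is piecewise linear with slopes 0 and -1.\<close>

lemma deadzone_lipschitz:
  fixes ub :: "real^'m::finite"
  assumes "\<forall>i. 0 < ub$i"
  shows "1-lipschitz_on U (dz ub)"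
proof (rule lipschitz_onI)
  fix v w
  have "norm (dz ub v - dz ub w) \<le> norm (v - w)"
  proof (rule norm_le_componentwise_cart)
    fix i
    show "norm ((dz ub v - dz ub w) $ i) \<le> norm ((v - w) $ i)"
      using assms[rule_format, of i] by (auto simp: dz_def sat_component min_def max_def)
  qed
  then show "dist (dz ub v) (dz ub w) \<le> 1 * dist v w"
    by (simp add: dist_norm)
qed simp

text \<open>The flow map is a linear map, plus a linear map after the deadzone after a linear map,
  plus the constant timer velocity. The Lipschitz bound is global, so local existence applies from
  any point.\<close>

lemma fcl_lipschitz:
  fixes A :: "real^'n::finite^'n" and B :: "real^'m::finite^'n" and K :: "real^'n^'m"
  assumes "\<forall>i. 0 < ub$i"
  obtains L where "L-lipschitz_on UNIV (fcl A B K ub :: _ \<Rightarrow> _ \<times> _ \<times> (real^'q::finite))"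
proof -
  let ?lin = "\<lambda>x :: (real^'n) \<times> (real^'n) \<times> (real^'q). ((A + B ** K) *v fst x - (B ** K) *v fst (snd x), A *v fst (snd x), 0 :: real^'q)"
  let ?k = "\<lambda>x :: (real^'n) \<times> (real^'n) \<times> (real^'q). K *v fst x - K *v fst (snd x)"
  let ?b = "\<lambda>v. (B *v v, 0 :: real^'n, 0 :: real^'q)"
  have mv: "bounded_linear (\<lambda>x. M *v g x)" if "bounded_linear g"
    for M :: "real^'a::finite^'b::finite" and g :: "'x::real_normed_vector \<Rightarrow> real^'a"
    using bounded_linear_compose[OF matrix_vector_mul_bounded_linear that] .
  have "bounded_linear ?lin"
    by (intro bounded_linear_Pair bounded_linear_sub mv bounded_linear_zero bounded_linear_fst
        bounded_linear_fst_comp bounded_linear_snd)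
  then obtain L1 where L1: "L1-lipschitz_on UNIV ?lin"
    using bounded_linear.lipschitz_boundE by blast
  have "bounded_linear ?k"
    by (intro bounded_linear_sub mv bounded_linear_fst bounded_linear_fst_comp bounded_linear_snd)
  then obtain L2 where L2: "L2-lipschitz_on UNIV ?k"
    using bounded_linear.lipschitz_boundE by blast
  have "bounded_linear ?b"
    by (intro bounded_linear_Pair mv bounded_linear_zero bounded_linear_ident)
  then obtain L3 where L3: "L3-lipschitz_on UNIV ?b"
    using bounded_linear.lipschitz_boundE by blast
  have "(L1 + L3 * (1 * L2) + 0)-lipschitz_on UNIV (\<lambda>x. ?lin x + ?b (dz ub (?k x)) + (0, 0, - (\<chi> i. 1)))"
    by (intro lipschitz_on_add L1 lipschitz_on_constant lipschitz_on_compose2[of _ _ "\<lambda>x. dz ub (?k x)" _ ?b]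
        lipschitz_on_compose2[of _ _ ?k _ "dz ub"] L2 deadzone_lipschitz assms lipschitz_on_subset[OF L3]) auto
  moreover have "(\<lambda>x. ?lin x + ?b (dz ub (?k x)) + (0, 0, - (\<chi> i. 1))) = fcl A B K ub"
    by (auto simp: fcl_def fun_eq_iff)
  ultimately show ?thesis
    using that by metis
qed

section \<open>The Lyapunov function\<close>

lemma Tset_eq_cbox: "Tset T2 = cbox 0 (\<chi> i. T2 i)"
  by (auto simp: Tset_def mem_box_cart)

lemma compact_Tset: "compact (Tset T2)"
  by (simp add: Tset_eq_cbox)

text \<open>The block is kept as a vector of the full space, so that \<open>Rb\<close> can act on it
  directly.\<close>

definition block_proj :: "('n \<Rightarrow> 'q) \<Rightarrow> 'q \<Rightarrow> real^'n \<Rightarrow> real^'n" where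
  "block_proj blk j \<eta> = (\<chi> k. if blk k = j then \<eta>$k else 0)"

lemma block_proj_hmap:
  "block_proj blk j (hmap blk i \<eta>) = (if j = i then 0 else block_proj blk j \<eta>)"
  by (auto simp: block_proj_def hmap_def vec_eq_iff)

lemma Rtau_mult_component:
  fixes Rb :: "real^'n::finite^'n"
  shows "(Rtau blk \<sigma> Rb \<tau> *v v) $ k = exp (\<sigma> (blk k) * \<tau>$(blk k)) * (Rb *v v) $ k"
  by (simp add: Rtau_def matrix_vector_mult_def sum_distrib_left mult.assoc)

lemma Sig_mult_component:
  fixes blk :: "'n::finite \<Rightarrow> 'q::finite"
  shows "(Sig blk \<sigma> *v v) $ k = \<sigma> (blk k) * v $ k"
  by (simp add: Sig_def matrix_vector_mult_def mult_delta_left)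

text \<open>\<open>Rb\<close> does not mix blocks and each weight is constant on a block. All
  dependence on \<tau> thus sits in scalar factors of fixed block forms, and comparing
  \<open>Rtau\<close> at different timers reduces to comparing exponentials.\<close>

lemma inner_Rtau_blocks:
  fixes Rb :: "real^'n::finite^'n" and blk :: "'n \<Rightarrow> 'q::finite"
  assumes "\<forall>k l. blk k \<noteq> blk l \<longrightarrow> Rb$k$l = 0"
  shows "inner \<eta> (Rtau blk \<sigma> Rb \<tau> *v \<eta>) =
    (\<Sum>j\<in>UNIV. exp (\<sigma> j * \<tau>$j) * inner (block_proj blk j \<eta>) (Rb *v block_proj blk j \<eta>))"
proof -
  have *: "(Rb *v block_proj blk (blk k) \<eta>) $ k = (Rb *v \<eta>) $ k" for k
    unfolding matrix_vector_mult_def block_proj_def using assms by (auto intro!: sum.cong)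
  have "(\<Sum>j\<in>UNIV. exp (\<sigma> j * \<tau>$j) * inner (block_proj blk j \<eta>) (Rb *v block_proj blk j \<eta>))
    = (\<Sum>j\<in>UNIV. \<Sum>k\<in>UNIV. if blk k = j then exp (\<sigma> j * \<tau>$j) * (\<eta>$k * (Rb *v block_proj blk j \<eta>)$k) else 0)"
    unfolding inner_vec_def sum_distrib_left by (intro sum.cong refl) (simp add: block_proj_def)
  also have "\<dots> = (\<Sum>k\<in>UNIV. exp (\<sigma> (blk k) * \<tau>$(blk k)) * (\<eta>$k * (Rb *v block_proj blk (blk k) \<eta>)$k))"
    by (subst sum.swap) simp
  also have "\<dots> = inner \<eta> (Rtau blk \<sigma> Rb \<tau> *v \<eta>)"
    by (simp add: * inner_vec_def Rtau_mult_component mult_ac)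
  finally show ?thesis
    by simp
qed

lemma Rtau_zero: "Rtau blk \<sigma> Rb 0 = Rb"
  by (simp add: Rtau_def)

text \<open>\<open>Rtau\<close> scales rows only. Symmetry survives because a nonzero entry joins
  two indices of one block, which carry the same weight.\<close>

lemma Rtau_symmetric:
  assumes "\<forall>k l. blk k \<noteq> blk l \<longrightarrow> Rb$k$l = 0" "transpose Rb = Rb"
  shows "transpose (Rtau blk \<sigma> Rb \<tau>) = Rtau blk \<sigma> Rb \<tau>"
proof -
  have "Rb$l$k = Rb$k$l" for k l
    using assms(2) by (metis transpose_def vec_lambda_beta)
  then have "exp (\<sigma> (blk l) * \<tau>$(blk l)) * Rb$l$k = exp (\<sigma> (blk k) * \<tau>$(blk k)) * Rb$k$l" for k l
    using assms(1) by (cases "blk k = blk l") auto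
  then show ?thesis
    by (simp add: Rtau_def transpose_def vec_eq_iff)
qed

locale saturated_lmi =
  fixes A :: "real^'n::finite^'n" and B :: "real^'m::finite^'n" and K :: "real^'n^'m"
    and ub :: "real^'m" and blk :: "'n \<Rightarrow> 'q::finite" and T1 T2 :: "'q \<Rightarrow> real"
    and W Rb :: "real^'n^'n" and S :: "real^'m^'m" and \<sigma> :: "'q \<Rightarrow> real"
    and \<mu> :: real and Z J :: "real^'n^'m"
  assumes ub_pos: "\<forall>i. 0 < ub$i"
    and T_pos: "\<forall>i. 0 < T1 i \<and> T1 i \<le> T2 i"
    and W_sym: "transpose W = W"
    and W_pd: "\<forall>v. v \<noteq> 0 \<longrightarrow> 0 < inner v (W *v v)"
    and Rb_blockdiag: "\<forall>k l. blk k \<noteq> blk l \<longrightarrow> Rb$k$l = 0"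
    and Rb_sym: "transpose Rb = Rb"
    and Rj_pd: "\<forall>j v. v \<noteq> 0 \<and> (\<forall>k. blk k \<noteq> j \<longrightarrow> v$k = 0) \<longrightarrow> 0 < inner v (Rb *v v)"
    and S_diag: "\<forall>i k. i \<noteq> k \<longrightarrow> S$i$k = 0"
    and S_pos: "\<forall>i. 0 < S$i$i"
    and \<sigma>_pos: "\<forall>j. 0 < \<sigma> j"
    and \<mu>_pos: "0 < \<mu>"
    and lmi1: "\<forall>i. psd_op (LMI1 W Rb Z J ub \<mu> i)"
    and lmi2: "\<forall>\<tau>\<in>Tset T2. nd_op (Mtau A B K W Z J S blk \<sigma> Rb \<tau>)"
begin

abbreviation R :: "real^'q \<Rightarrow> real^'n^'n" where
  "R \<equiv> Rtau blk \<sigma> Rb"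

definition V :: "(real^'n) \<times> (real^'n) \<times> (real^'q) \<Rightarrow> real" where
  "V = (\<lambda>(xp, \<eta>, \<tau>). inner xp (matrix_inv W *v xp) + inner \<eta> (R \<tau> *v \<eta>))"

text \<open>The derivative of \<open>V\<close> along \<open>fcl\<close>, as \<open>V_flow\<close>
  shows. The \<open>Sig\<close> term is the derivative of the weights, negative because the timers
  decrease at unit rate.\<close>

definition flow_rate :: "(real^'n) \<times> (real^'n) \<times> (real^'q) \<Rightarrow> real" where
  "flow_rate = (\<lambda>(xp, \<eta>, \<tau>).
     2 * inner (matrix_inv W *v xp)
       ((A + B ** K) *v xp - (B ** K) *v \<eta> + B *v dz ub (K *v xp - K *v \<eta>))
     + 2 * inner \<eta> (R \<tau> *v (A *v \<eta>)) - inner \<eta> (Sig blk \<sigma> *v (R \<tau> *v \<eta>)))"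

lemma W_inverse:
  "W *v (matrix_inv W *v x) = x" "transpose (matrix_inv W) = matrix_inv W"
  "x \<noteq> 0 \<Longrightarrow> 0 < inner x (matrix_inv W *v x)"
  using positive_definite_inverse[OF W_sym] W_pd by auto

lemma block_form_pos:
  assumes "block_proj blk j \<eta> \<noteq> 0"
  shows "0 < inner (block_proj blk j \<eta>) (Rb *v block_proj blk j \<eta>)"
proof -
  have "\<forall>k. blk k \<noteq> j \<longrightarrow> block_proj blk j \<eta> $ k = 0"
    by (simp add: block_proj_def)
  then show ?thesis
    using Rj_pd assms by blast
qed

lemma block_form_nonneg: "0 \<le> inner (block_proj blk j \<eta>) (Rb *v block_proj blk j \<eta>)"
  using block_form_pos by (cases "block_proj blk j \<eta> = 0") (auto intro: less_imp_le)

lemma Rb_pd: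
  assumes "v \<noteq> 0"
  shows "0 < inner v (Rb *v v)"
proof -
  obtain k where k: "v$k \<noteq> 0"
    using assms by (auto simp: vec_eq_iff)
  then have "block_proj blk (blk k) v \<noteq> 0"
    by (auto simp: block_proj_def vec_eq_iff)
  then have pos: "0 < inner (block_proj blk (blk k) v) (Rb *v block_proj blk (blk k) v)"
    by (rule block_form_pos)
  have "inner v (Rb *v v) = (\<Sum>j\<in>UNIV. inner (block_proj blk j v) (Rb *v block_proj blk j v))"
    using inner_Rtau_blocks[OF Rb_blockdiag, of v \<sigma> 0] by (simp add: Rtau_zero)
  then show ?thesis
    using pos block_form_nonneg by (auto intro!: sum_pos2[of _ "blk k"])
qed

text \<open>Timers in \<open>Tset T2\<close> are nonnegative, so every weight is at least 1. This
  connects the first matrix inequality, which contains \<open>Rb\<close>, with \<open>V\<close>,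
  which contains \<open>R \<tau>\<close>.\<close>

lemma Rb_le_R:
  assumes "\<tau> \<in> Tset T2"
  shows "inner \<eta> (Rb *v \<eta>) \<le> inner \<eta> (R \<tau> *v \<eta>)"
proof -
  have "1 \<le> exp (\<sigma> j * \<tau>$j)" for j
    using assms \<sigma>_pos by (auto simp: Tset_def less_imp_le)
  then have "(\<Sum>j\<in>UNIV. 1 * inner (block_proj blk j \<eta>) (Rb *v block_proj blk j \<eta>)) \<le> inner \<eta> (R \<tau> *v \<eta>)"
    unfolding inner_Rtau_blocks[OF Rb_blockdiag] by (intro sum_mono mult_right_mono block_form_nonneg)
  then show ?thesis
    using inner_Rtau_blocks[OF Rb_blockdiag, of \<eta> \<sigma> 0] by (simp add: Rtau_zero)
qed

lemma R_bounded:
  obtains c where "c > 0" "\<And>\<tau> \<eta>. \<tau> \<in> Tset T2 \<Longrightarrow> inner \<eta> (R \<tau> *v \<eta>) \<le> c * (norm \<eta>)\<^sup>2"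
proof -
  obtain c where c: "c > 0" "\<And>\<eta>. inner \<eta> (Rb *v \<eta>) \<le> c * (norm \<eta>)\<^sup>2"
    using matrix_form_bounded by blast
  \<comment> \<open>All summands are nonnegative, so the sum dominates every single
    exponent.\<close>
  define e where "e = exp (\<Sum>j\<in>UNIV. \<sigma> j * T2 j)"
  have nn: "0 \<le> \<sigma> j * T2 j" for j
    using \<sigma>_pos T_pos by (meson less_imp_le mult_nonneg_nonneg order_trans)
  have "inner \<eta> (R \<tau> *v \<eta>) \<le> e * c * (norm \<eta>)\<^sup>2" if \<tau>: "\<tau> \<in> Tset T2" for \<tau> \<eta>
  proof -
    have "exp (\<sigma> j * \<tau>$j) \<le> e" for j
    proof -
      have "\<sigma> j * \<tau>$j \<le> \<sigma> j * T2 j"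
        using \<tau> \<sigma>_pos by (auto simp: Tset_def less_imp_le)
      also have "\<dots> \<le> (\<Sum>j\<in>UNIV. \<sigma> j * T2 j)"
        using nn by (intro member_le_sum) auto
      finally show ?thesis
        by (simp add: e_def)
    qed
    then have "inner \<eta> (R \<tau> *v \<eta>) \<le>
        (\<Sum>j\<in>UNIV. e * inner (block_proj blk j \<eta>) (Rb *v block_proj blk j \<eta>))"
      unfolding inner_Rtau_blocks[OF Rb_blockdiag]
      by (intro sum_mono mult_right_mono block_form_nonneg)
    also have "\<dots> = e * inner \<eta> (Rb *v \<eta>)"
      using inner_Rtau_blocks[OF Rb_blockdiag, of \<eta> \<sigma> 0] by (simp add: Rtau_zero sum_distrib_left)
    also have "\<dots> \<le> e * (c * (norm \<eta>)\<^sup>2)"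
      using c(2) by (intro mult_left_mono) (auto simp: e_def)
    finally show ?thesis
      by (simp add: mult.assoc)
  qed
  then show ?thesis
    using that[of "e * c"] c(1) by (auto simp: e_def)
qed

lemma V_bounds:
  obtains m1 m2 where "m1 > 0" "m2 > 0"
    "\<And>xp \<eta> \<tau>. \<tau> \<in> Tset T2 \<Longrightarrow> m1 * (norm (xp, \<eta>))\<^sup>2 \<le> V (xp, \<eta>, \<tau>)"
    "\<And>xp \<eta> \<tau>. \<tau> \<in> Tset T2 \<Longrightarrow> V (xp, \<eta>, \<tau>) \<le> m2 * (norm (xp, \<eta>))\<^sup>2"
proof -
  obtain a1 where a1: "a1 > 0" "\<And>v. a1 * (norm v)\<^sup>2 \<le> inner v (matrix_inv W *v v)"
    using matrix_form_coercive[of "matrix_inv W"] W_inverse(3) by blast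
  obtain a2 where a2: "a2 > 0" "\<And>v. a2 * (norm v)\<^sup>2 \<le> inner v (Rb *v v)"
    using matrix_form_coercive[of Rb] Rb_pd by blast
  obtain b1 where b1: "b1 > 0" "\<And>v. inner v (matrix_inv W *v v) \<le> b1 * (norm v)\<^sup>2"
    using matrix_form_bounded by blast
  obtain b2 where b2: "b2 > 0" "\<And>\<tau> \<eta>. \<tau> \<in> Tset T2 \<Longrightarrow> inner \<eta> (R \<tau> *v \<eta>) \<le> b2 * (norm \<eta>)\<^sup>2"
    using R_bounded by blast
  have n: "(norm (x, y))\<^sup>2 = (norm x)\<^sup>2 + (norm y)\<^sup>2" for x y :: "real^'n"
    by (simp add: norm_Pair)
  show ?thesis
  proof (rule that[of "min a1 a2" "max b1 b2"])
    fix xp \<eta> :: "real^'n" and \<tau> :: "real^'q"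
    assume \<tau>: "\<tau> \<in> Tset T2"
    have "min a1 a2 * (norm xp)\<^sup>2 \<le> a1 * (norm xp)\<^sup>2" "min a1 a2 * (norm \<eta>)\<^sup>2 \<le> a2 * (norm \<eta>)\<^sup>2"
      by (auto intro: mult_right_mono)
    then show "min a1 a2 * (norm (xp, \<eta>))\<^sup>2 \<le> V (xp, \<eta>, \<tau>)"
      using a1(2)[of xp] a2(2)[of \<eta>] Rb_le_R[OF \<tau>, of \<eta>] unfolding V_def n distrib_left by simp
    have "b1 * (norm xp)\<^sup>2 \<le> max b1 b2 * (norm xp)\<^sup>2" "b2 * (norm \<eta>)\<^sup>2 \<le> max b1 b2 * (norm \<eta>)\<^sup>2"
      by (auto intro: mult_right_mono)
    then show "V (xp, \<eta>, \<tau>) \<le> max b1 b2 * (norm (xp, \<eta>))\<^sup>2"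
      using b1(2)[of xp] b2(2)[OF \<tau>, of \<eta>] unfolding V_def n distrib_left by simp
  qed (use a1(1) a2(1) b1(1) b2(1) in auto)
qed

text \<open>Written so that substituting \<open>W *v p = xp\<close> and \<open>S *v \<xi>\<close> =
  deadzone displays \<open>flow_rate\<close> and the sector term. Symmetry of \<open>W\<close> moves
  the transposed factor of the upper right block onto \<xi>.\<close>

lemma Mtau_form:
  "inner (p, \<eta>, \<xi>) (Mtau A B K W Z J S blk \<sigma> Rb \<tau> (p, \<eta>, \<xi>)) =
     2 * inner p ((A + B ** K) *v (W *v p)) - 2 * inner p ((B ** K) *v \<eta>)
     + 2 * inner p (B *v (S *v \<xi>)) - 2 * inner \<xi> (K *v (W *v p)) - 2 * inner \<xi> (Z *v p)
     + 2 * inner \<eta> (R \<tau> *v (A *v \<eta>)) - inner \<eta> (Sig blk \<sigma> *v (R \<tau> *v \<eta>))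
     + 2 * inner \<xi> (K *v \<eta>) - 2 * inner \<xi> (J *v \<eta>) - 2 * inner \<xi> (S *v \<xi>)"
proof -
  have neg: "(- M) *v v = - (M *v v)" for M :: "real^'a::finite^'b::finite" and v
    using matrix_vector_mult_diff_rdistrib[of 0 M v] by simp
  have "inner p (W *v (\<xi> v* K)) = inner \<xi> (K *v (W *v p))"
    using inner_symmetric_matrix[OF W_sym, of p "\<xi> v* K"] inner_vector_matrix[of "W *v p" \<xi> K]
    by (simp add: inner_commute)
  then show ?thesis
    unfolding Mtau_def inner_block3
    by (simp add: inner_He matrix_vector_mult_diff_rdistrib matrix_vector_mul_assoc[symmetric]
        scaleR_matrix_vector_assoc[symmetric] neg inner_diff_right inner_vector_matrix algebra_simps)
qed

text \<open>Negative definiteness is assumed for each \<tau> separately; compactness of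
  \<open>Tset T2\<close> turns it into one constant. The \<xi> part of the norm is given away at the
  end, since \<open>V\<close> is controlled by p and \<eta>.\<close>

lemma Mtau_coercive:
  obtains c where "c > 0"
    "\<And>\<tau> p \<eta> \<xi>. \<tau> \<in> Tset T2 \<Longrightarrow>
       inner (p, \<eta>, \<xi>) (Mtau A B K W Z J S blk \<sigma> Rb \<tau> (p, \<eta>, \<xi>)) \<le> - c * ((norm p)\<^sup>2 + (norm \<eta>)\<^sup>2)"
proof -
  define g where "g \<tau> w = - inner w (Mtau A B K W Z J S blk \<sigma> Rb \<tau> w)" for \<tau> w
  have mv: "continuous_on X (\<lambda>x. M *v f x)" if "continuous_on X f"
    for M :: "real^'a::finite^'b::finite" and X :: "'x::topological_space set" and f
    using bounded_linear.continuous_on[OF matrix_vector_mul_bounded_linear that] .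
  have R: "continuous_on X (\<lambda>x. R (f x) *v h x)" if "continuous_on X f" "continuous_on X h"
    for X :: "'x::topological_space set" and f h
  proof -
    have "continuous_on X (\<lambda>x. \<chi> k. exp (\<sigma> (blk k) * f x $ (blk k)) * (Rb *v h x) $ k)"
      by (intro continuous_intros mv that)
    moreover have "R (f x) *v h x = (\<chi> k. exp (\<sigma> (blk k) * f x $ (blk k)) * (Rb *v h x) $ k)" for x
      by (simp add: vec_eq_iff Rtau_mult_component)
    ultimately show ?thesis
      by simp
  qed
  obtain c where c: "c > 0" "\<And>\<tau> w. \<tau> \<in> Tset T2 \<Longrightarrow> c * (norm w)\<^sup>2 \<le> g \<tau> w"
  proof (rule quadratic_form_coercive[of "Tset T2" g])
    show "continuous_on (Tset T2 \<times> UNIV) (\<lambda>(\<tau>, w). g \<tau> w)"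
    proof -
      have eq: "(\<lambda>(\<tau>, w). g \<tau> w) = (\<lambda>x. g (fst x) (fst (snd x), fst (snd (snd x)), snd (snd (snd x))))"
        by auto
      show ?thesis
        unfolding eq unfolding g_def Mtau_form
        by (intro continuous_intros mv R)
    qed
    show "g \<tau> (r *\<^sub>R w) = r\<^sup>2 * g \<tau> w" for \<tau> r w
    proof (cases w)
      case (fields p \<eta> \<xi>)
      show ?thesis
        unfolding fields g_def scaleR_Pair Mtau_form
        by (simp add: matrix_vector_mult_scaleR power2_eq_square algebra_simps)
    qed
    show "0 < g \<tau> w" if "\<tau> \<in> Tset T2" "w \<noteq> 0" for \<tau> w
      using bspec[OF lmi2 that(1)] that(2) unfolding g_def nd_op_def by (metis neg_0_less_iff_less)
  qed (use compact_Tset in blast)+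
  show ?thesis
  proof (rule that[OF c(1)])
    fix \<tau> p \<eta> \<xi>
    assume "\<tau> \<in> Tset T2"
    from c(2)[OF this, of "(p, \<eta>, \<xi>)"]
    have "inner (p, \<eta>, \<xi>) (Mtau A B K W Z J S blk \<sigma> Rb \<tau> (p, \<eta>, \<xi>))
        \<le> - c * ((norm p)\<^sup>2 + (norm \<eta>)\<^sup>2 + (norm \<xi>)\<^sup>2)"
      by (simp add: g_def norm_Pair add.assoc)
    also have "\<dots> \<le> - c * ((norm p)\<^sup>2 + (norm \<eta>)\<^sup>2)"
      using c(1) by (intro mult_left_mono_neg) auto
    finally show "inner (p, \<eta>, \<xi>) (Mtau A B K W Z J S blk \<sigma> Rb \<tau> (p, \<eta>, \<xi>))
        \<le> - c * ((norm p)\<^sup>2 + (norm \<eta>)\<^sup>2)" .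
  qed
qed

text \<open>A Schur complement by hand: with \<open>p\<close> and \<eta> fixed, the first matrix
  inequality says that a quadratic polynomial in the third, scalar variable \<open>s\<close> is
  nonnegative. Its minimum bounds the squared component \<open>d\<^sup>2\<close> by
  \<open>u\<^sup>2 * N / \<mu>\<close>, and \<open>N \<le> V \<le> \<mu>\<close>.\<close>

lemma LMI1_bound:
  assumes \<tau>: "\<tau> \<in> Tset T2" and V: "V (xp, \<eta>, \<tau>) \<le> \<mu>"
  shows "\<bar>(Z *v (matrix_inv W *v xp) + J *v \<eta>) $ i\<bar> \<le> ub$i"
proof -
  define p where "p = matrix_inv W *v xp"
  define d where "d = (Z *v p + J *v \<eta>) $ i"
  define u where "u = ub$i"
  have u: "u > 0"
    using ub_pos by (simp add: u_def)
  define N where "N = inner p (W *v p) + inner \<eta> (Rb *v \<eta>)"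
  have "N \<le> V (xp, \<eta>, \<tau>)"
    using Rb_le_R[OF \<tau>, of \<eta>] by (simp add: N_def V_def p_def W_inverse(1) inner_commute)
  then have "N \<le> \<mu>"
    using V by simp
  have quad: "0 \<le> N + 2 * s * d + u\<^sup>2 / \<mu> * s\<^sup>2" for s
  proof -
    have col: "inner v (((\<chi> k l. M$i$k) :: real^1^'n) *v (\<chi> l. s)) = s * (M *v v) $ i"
      for M :: "real^'n^'m" and v :: "real^'n"
      by (simp add: inner_vec_def matrix_vector_mult_def sum_distrib_left UNIV_1 mult_ac)
    have last: "inner (\<chi> l. s) (mat (u\<^sup>2 / \<mu>) *v (\<chi> l. s) :: real^1) = u\<^sup>2 / \<mu> * s\<^sup>2"
      by (simp add: inner_vec_def matrix_vector_mult_def mat_def power2_eq_square UNIV_1)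
    have "0 \<le> inner (p, \<eta>, (\<chi> l. s)) (LMI1 W Rb Z J ub \<mu> i (p, \<eta>, (\<chi> l. s)))"
      using lmi1 by (auto simp: psd_op_def)
    also have "\<dots> = N + 2 * s * d + u\<^sup>2 / \<mu> * s\<^sup>2"
      unfolding LMI1_def inner_block3 col last[unfolded u_def]
      by (simp add: N_def d_def u_def algebra_simps)
    finally show ?thesis .
  qed
  \<comment> \<open>The value of \<open>s\<close> inserted here is the minimiser of the
    polynomial.\<close>
  have "0 \<le> N - d\<^sup>2 * \<mu> / u\<^sup>2"
    using quad[of "- d * \<mu> / u\<^sup>2"] u \<mu>_pos by (simp add: field_simps power2_eq_square)
  then have "d\<^sup>2 * \<mu> / u\<^sup>2 \<le> \<mu>"
    using \<open>N \<le> \<mu>\<close> by linarith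
  then have "d\<^sup>2 \<le> u\<^sup>2"
    using u \<mu>_pos by (simp add: field_simps)
  then have "\<bar>d\<bar> \<le> u"
    using u by (simp add: abs_le_square_iff[symmetric])
  then show ?thesis
    by (simp add: d_def u_def p_def)
qed

lemma flow_rate_decay:
  obtains c where "c > 0"
    "\<And>xp \<eta> \<tau>. \<tau> \<in> Tset T2 \<Longrightarrow> V (xp, \<eta>, \<tau>) \<le> \<mu> \<Longrightarrow> flow_rate (xp, \<eta>, \<tau>) \<le> - c * V (xp, \<eta>, \<tau>)"
proof -
  obtain c where c: "c > 0" "\<And>\<tau> p \<eta> \<xi>. \<tau> \<in> Tset T2 \<Longrightarrow>
       inner (p, \<eta>, \<xi>) (Mtau A B K W Z J S blk \<sigma> Rb \<tau> (p, \<eta>, \<xi>)) \<le> - c * ((norm p)\<^sup>2 + (norm \<eta>)\<^sup>2)"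
    using Mtau_coercive by blast
  obtain b1 where b1: "b1 > 0" "\<And>v. inner v (W *v v) \<le> b1 * (norm v)\<^sup>2"
    using matrix_form_bounded by blast
  obtain b2 where b2: "b2 > 0" "\<And>\<tau> \<eta>. \<tau> \<in> Tset T2 \<Longrightarrow> inner \<eta> (R \<tau> *v \<eta>) \<le> b2 * (norm \<eta>)\<^sup>2"
    using R_bounded by blast
  define b where "b = max b1 b2"
  have b: "b > 0" "b1 \<le> b" "b2 \<le> b"
    using b1(1) by (auto simp: b_def)
  show ?thesis
  \<comment> \<open>\<open>c\<close> measures decay against the squared norms of p and \<eta>, and
    \<open>b\<close> times the sum of these squares bounds \<open>V\<close>; hence the
    quotient.\<close>
  proof (rule that[of "c / b"])
    fix xp \<eta> :: "real^'n" and \<tau> :: "real^'q"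
    assume \<tau>: "\<tau> \<in> Tset T2" and V: "V (xp, \<eta>, \<tau>) \<le> \<mu>"
    define p where "p = matrix_inv W *v xp"
    have Wp: "W *v p = xp"
      by (simp add: p_def W_inverse(1))
    define \<phi> where "\<phi> = dz ub (K *v xp - K *v \<eta>)"
    define \<xi> :: "real^'m" where "\<xi> = (\<chi> i. \<phi>$i / S$i$i)"
    have S\<xi>: "S *v \<xi> = \<phi>"
    proof -
      have "(S *v \<xi>) $ i = \<phi> $ i" for i
      proof -
        have "(S *v \<xi>) $ i = (\<Sum>k\<in>UNIV. if k = i then S$i$i * \<xi>$i else 0)"
          unfolding matrix_vector_mult_def vec_lambda_beta using S_diag by (intro sum.cong refl) auto
        then show ?thesis
          using S_pos[rule_format, of i] by (simp add: \<xi>_def)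
      qed
      then show ?thesis
        by (simp add: vec_eq_iff)
    qed
    \<comment> \<open>The componentwise sector inequality may be divided by the positive diagonal
      entries of \<open>S\<close>, which produces \<xi> as left factor.\<close>
    have sector: "inner \<xi> (\<phi> + (K *v xp - K *v \<eta>) + (Z *v p + J *v \<eta>)) \<le> 0"
      unfolding inner_vec_def
    proof (rule sum_nonpos)
      fix i
      have "\<phi>$i * (\<phi>$i + (K *v xp - K *v \<eta>)$i - - (Z *v p + J *v \<eta>)$i) \<le> 0"
        unfolding \<phi>_def using ub_pos LMI1_bound[OF \<tau> V, of i]
        by (intro deadzone_sector) (auto simp: p_def)
      then have "\<phi>$i * (\<phi>$i + (K *v xp - K *v \<eta>)$i - - (Z *v p + J *v \<eta>)$i) / S$i$i \<le> 0"
        using S_pos by (intro divide_nonpos_pos) auto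
      then show "inner (\<xi>$i) ((\<phi> + (K *v xp - K *v \<eta>) + (Z *v p + J *v \<eta>))$i) \<le> 0"
        unfolding diff_minus_eq_add by (simp add: \<xi>_def)
    qed
    \<comment> \<open>Apart from the input term \<open>B *v (S *v \<xi>)\<close>, which is the
      deadzone input of the flow, the \<xi> terms of \<open>Mtau\<close> add up to minus twice the
      sector expression. Adding that expression twice cancels them.\<close>
    have "flow_rate (xp, \<eta>, \<tau>) = inner (p, \<eta>, \<xi>) (Mtau A B K W Z J S blk \<sigma> Rb \<tau> (p, \<eta>, \<xi>))
        + 2 * inner \<xi> (\<phi> + (K *v xp - K *v \<eta>) + (Z *v p + J *v \<eta>))"
      unfolding Mtau_form flow_rate_def Wp S\<xi>
      by (simp add: p_def[symmetric] \<phi>_def[symmetric] inner_add_right inner_diff_right algebra_simps)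
    also have "\<dots> \<le> - c * ((norm p)\<^sup>2 + (norm \<eta>)\<^sup>2)"
      using sector c(2)[OF \<tau>, of p \<eta> \<xi>] by linarith
    also have "\<dots> \<le> - (c / b) * V (xp, \<eta>, \<tau>)"
    proof -
      have "V (xp, \<eta>, \<tau>) = inner p (W *v p) + inner \<eta> (R \<tau> *v \<eta>)"
        by (simp add: V_def Wp inner_commute p_def[symmetric])
      also have "\<dots> \<le> b1 * (norm p)\<^sup>2 + b2 * (norm \<eta>)\<^sup>2"
        using b1(2) b2(2)[OF \<tau>] by (intro add_mono)
      also have "\<dots> \<le> b * ((norm p)\<^sup>2 + (norm \<eta>)\<^sup>2)"
        using b unfolding distrib_left by (intro add_mono mult_right_mono) auto
      finally have "c / b * V (xp, \<eta>, \<tau>) \<le> c / b * (b * ((norm p)\<^sup>2 + (norm \<eta>)\<^sup>2))"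
        using c(1) b(1) by (intro mult_left_mono) auto
      then show ?thesis
        using b(1) by simp
    qed
    finally show "flow_rate (xp, \<eta>, \<tau>) \<le> - (c / b) * V (xp, \<eta>, \<tau>)" .
  qed (use c(1) b(1) in simp)
qed

end

section \<open>Solutions of the closed loop\<close>

lemma closed_Ccl: "closed (Ccl T2)"
  unfolding Ccl_def by (intro closed_Times closed_UNIV compact_imp_closed compact_Tset)

lemma Dcl_subset_Ccl: "Dcl T2 \<subseteq> Ccl T2"
  by (auto simp: Dcl_def Ccl_def Dset_def)

text \<open>The nearest point of the attractor keeps the timers and sets the rest to zero.\<close>

lemma infdist_Aset:
  fixes xp \<eta> :: "real^'n::finite" and \<tau> :: "real^'q::finite"
  assumes "\<tau> \<in> Tset T2"
  shows "infdist (xp, \<eta>, \<tau>) (Aset T2) = norm (xp, \<eta>)"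
proof (rule antisym)
  have "infdist (xp, \<eta>, \<tau>) (Aset T2) \<le> dist (xp, \<eta>, \<tau>) (0, 0, \<tau>)"
    using assms by (intro infdist_le) (auto simp: Aset_def)
  also have "\<dots> = norm (xp, \<eta>)"
    by (simp add: dist_norm norm_Pair)
  finally show "infdist (xp, \<eta>, \<tau>) (Aset T2) \<le> norm (xp, \<eta>)" .
  have ne: "(Aset T2 :: ((real^'n) \<times> (real^'n) \<times> (real^'q)) set) \<noteq> {}"
    using assms by (auto simp: Aset_def)
  show "norm (xp, \<eta>) \<le> infdist (xp, \<eta>, \<tau>) (Aset T2)"
    unfolding infdist_notempty[OF ne]
  proof (rule cINF_greatest[OF ne])
    fix a :: "(real^'n) \<times> (real^'n) \<times> (real^'q)"
    assume "a \<in> Aset T2"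
    then obtain c where "a = (0, 0, c)"
      by (auto simp: Aset_def)
    then show "norm (xp, \<eta>) \<le> dist (xp, \<eta>, \<tau>) a"
      by (simp add: dist_norm norm_Pair)
  qed
qed

lemma flow_components:
  assumes "(u has_vector_derivative fcl A B K ub (u t)) F"
  shows "((\<lambda>t. fst (u t)) has_vector_derivative
      (A + B ** K) *v fst (u t) - (B ** K) *v fst (snd (u t)) + B *v dz ub (K *v fst (u t) - K *v fst (snd (u t)))) F"
    and "((\<lambda>t. fst (snd (u t))) has_vector_derivative A *v fst (snd (u t))) F"
    and "((\<lambda>t. snd (snd (u t)) $ i) has_real_derivative -1) F"
proof -
  note d1 = bounded_linear.has_vector_derivative[OF bounded_linear_fst assms]
  note d2 = bounded_linear.has_vector_derivative[OF bounded_linear_snd assms]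
  note d3 = bounded_linear.has_vector_derivative[OF bounded_linear_fst d2]
  note d4 = bounded_linear.has_vector_derivative[OF bounded_linear_vec_nth[of i]
      bounded_linear.has_vector_derivative[OF bounded_linear_snd d2]]
  show "((\<lambda>t. fst (u t)) has_vector_derivative
      (A + B ** K) *v fst (u t) - (B ** K) *v fst (snd (u t)) + B *v dz ub (K *v fst (u t) - K *v fst (snd (u t)))) F"
    using d1 by (simp add: fcl_def case_prod_unfold)
  show "((\<lambda>t. fst (snd (u t))) has_vector_derivative A *v fst (snd (u t))) F"
    using d3 by (simp add: fcl_def case_prod_unfold)
  show "((\<lambda>t. snd (snd (u t)) $ i) has_real_derivative -1) F"
    using d4 by (simp add: fcl_def case_prod_unfold has_real_derivative_iff_has_vector_derivative)
qed

lemma timer_flow: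
  assumes der: "\<And>s. s \<in> {a..b} \<Longrightarrow> (u has_vector_derivative fcl A B K ub (u s)) (at s within {a..b})"
    and t: "t \<in> {a..b}"
  shows "snd (snd (u t)) $ i = snd (snd (u a)) $ i - (t - a)"
proof -
  have "((\<lambda>s. snd (snd (u s)) $ i + s) has_real_derivative 0) (at s within {a..b})" if "s \<in> {a..b}" for s
    using DERIV_add[OF flow_components(3)[OF der[OF that]] DERIV_ident] by simp
  then obtain k where "\<And>s. s \<in> {a..b} \<Longrightarrow> snd (snd (u s)) $ i + s = k"
    using has_field_derivative_zero_constant[of "{a..b}" "\<lambda>s. snd (snd (u s)) $ i + s"] by auto
  from this[of t] this[of a] show ?thesis
    using t by simp
qed

text \<open>Off the jump set every timer is strictly positive, so flowing is possible until the
  smallest one expires; \<open>k\<close> is that time, cut off at \<open>h\<close>. This supplies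
  the viability assumption of \<open>maximal_solution_complete\<close>.\<close>

lemma Ccl_viable:
  fixes A :: "real^'n::finite^'n" and B :: "real^'m::finite^'n"
    and u :: "real \<Rightarrow> (real^'n) \<times> (real^'n) \<times> (real^'q::finite)"
  assumes "u a \<in> Ccl T2 - Dcl T2" "h > 0"
    and der: "\<And>s. s \<in> {a..a+h} \<Longrightarrow> (u has_vector_derivative fcl A B K ub (u s)) (at s within {a..a+h})"
  shows "\<exists>k\<in>{0<..h}. \<forall>t\<in>{a..a+k}. u t \<in> Ccl T2"
proof -
  define \<tau> where "\<tau> t = snd (snd (u t))" for t
  have mem: "u t \<in> Ccl T2 \<longleftrightarrow> \<tau> t \<in> Tset T2" for t
    by (cases "u t") (auto simp: Ccl_def \<tau>_def)
  have "\<tau> a $ i \<noteq> 0" for i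
    using assms(1) by (cases "u a") (auto simp: Ccl_def Dcl_def Dset_def \<tau>_def)
  moreover have \<tau>a: "\<tau> a \<in> Tset T2"
    using assms(1) mem by auto
  ultimately have pos: "\<tau> a $ i > 0" for i
    by (simp add: Tset_def order_less_le)
  define k where "k = Min (insert h (range (\<lambda>i. \<tau> a $ i)))"
  have k: "k > 0" "k \<le> h"
    using assms(2) pos by (auto simp: k_def)
  have k_le: "k \<le> \<tau> a $ i" for i
    unfolding k_def by (intro Min_le) auto
  have "u t \<in> Ccl T2" if t: "t \<in> {a..a+k}" for t
  proof -
    have "\<tau> t $ i = \<tau> a $ i - (t - a)" for i
      unfolding \<tau>_def by (rule timer_flow[OF der]) (use t k in auto)
    moreover have "0 \<le> \<tau> a $ i - (t - a)" "\<tau> a $ i - (t - a) \<le> T2 i" for i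
    proof -
      show "0 \<le> \<tau> a $ i - (t - a)"
        using t k_le[of i] by auto
      have "\<tau> a $ i \<le> T2 i"
        using \<tau>a by (simp add: Tset_def)
      then show "\<tau> a $ i - (t - a) \<le> T2 i"
        using t by auto
    qed
    ultimately show ?thesis
      by (simp add: mem Tset_def)
  qed
  then show ?thesis
    using k by (intro bexI[of _ k]) auto
qed

context saturated_lmi
begin

section \<open>One jump and one instant of flow: effect on the state, \<open>V\<close> and the
  timers\<close>

lemma Gcl_subset_Ccl: "x \<in> Dcl T2 \<Longrightarrow> Gcl blk T1 T2 x \<subseteq> Ccl T2"
proof
  fix y
  assume "y \<in> Gcl blk T1 T2 x"
  then obtain xp \<eta> \<tau> i c where *: "x = (xp, \<eta>, \<tau>)" "\<tau> \<in> Dset T2 i" "y = (xp, hmap blk i \<eta>, c)" "c \<in> Ghat T1 T2 i \<tau>"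
    by (cases x) (auto simp: Gcl_def)
  have "0 \<le> c$k \<and> c$k \<le> T2 k" for k
    using * T_pos[rule_format, of i] by (cases "k = i") (auto simp: Ghat_def Dset_def Tset_def)
  then show "y \<in> Ccl T2"
    using * by (simp add: Ccl_def Tset_def)
qed

lemma Gcl_nonempty: "x \<in> Dcl T2 \<Longrightarrow> Gcl blk T1 T2 x \<noteq> {}"
proof -
  assume "x \<in> Dcl T2"
  then obtain xp \<eta> \<tau> i where x: "x = (xp, \<eta>, \<tau>)" "\<tau> \<in> Dset T2 i"
    by (cases x) (auto simp: Dcl_def)
  have "(\<chi> k. if k = i then T2 i else \<tau>$k) \<in> Ghat T1 T2 i \<tau>"
    using T_pos by (simp add: Ghat_def)
  then show ?thesis
    using x by (auto simp: Gcl_def)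
qed

text \<open>The only weight that changes is that of the reset block, where the new \<eta> vanishes;
  the other summands stay as they are.\<close>

lemma V_jump:
  assumes "y \<in> Gcl blk T1 T2 x"
  shows "V y \<le> V x"
proof -
  obtain xp \<eta> \<tau> i c where *: "x = (xp, \<eta>, \<tau>)" "\<tau> \<in> Dset T2 i" "y = (xp, hmap blk i \<eta>, c)" "c \<in> Ghat T1 T2 i \<tau>"
    using assms by (cases x) (auto simp: Gcl_def)
  have "inner (hmap blk i \<eta>) (R c *v hmap blk i \<eta>) \<le> inner \<eta> (R \<tau> *v \<eta>)"
    unfolding inner_Rtau_blocks[OF Rb_blockdiag]
  proof (rule sum_mono)
    fix j
    show "exp (\<sigma> j * c$j) * inner (block_proj blk j (hmap blk i \<eta>)) (Rb *v block_proj blk j (hmap blk i \<eta>))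
      \<le> exp (\<sigma> j * \<tau>$j) * inner (block_proj blk j \<eta>) (Rb *v block_proj blk j \<eta>)"
      using *(4) block_form_nonneg[of j \<eta>] by (auto simp: block_proj_hmap Ghat_def)
  qed
  then show ?thesis
    by (simp add: * V_def)
qed

text \<open>The expired timer contributes 0 before the jump and at least \<open>T1 i\<close> after
  it.\<close>

lemma timer_sum_jump:
  assumes "y \<in> Gcl blk T1 T2 x" "\<And>i. Tm \<le> T1 i"
  shows "(\<Sum>i\<in>UNIV. snd (snd x) $ i) + Tm \<le> (\<Sum>i\<in>UNIV. snd (snd y) $ i)"
proof -
  obtain xp \<eta> \<tau> i c where *: "x = (xp, \<eta>, \<tau>)" "\<tau> \<in> Dset T2 i" "y = (xp, hmap blk i \<eta>, c)" "c \<in> Ghat T1 T2 i \<tau>"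
    using assms by (cases x) (auto simp: Gcl_def)
  have "(\<Sum>k\<in>UNIV. \<tau> $ k) = (\<Sum>k\<in>UNIV - {i}. \<tau> $ k)"
    using *(2) by (subst sum.remove[of _ i]) (auto simp: Dset_def)
  moreover have "(\<Sum>k\<in>UNIV. c $ k) = c $ i + (\<Sum>k\<in>UNIV - {i}. c $ k)"
    by (rule sum.remove) auto
  moreover have "(\<Sum>k\<in>UNIV - {i}. c $ k) = (\<Sum>k\<in>UNIV - {i}. \<tau> $ k)"
    using *(4) by (intro sum.cong) (auto simp: Ghat_def)
  moreover have "Tm \<le> c $ i"
    using *(4) assms(2)[of i] by (simp add: Ghat_def)
  ultimately show ?thesis
    by (simp add: *)
qed

lemma V_flow:
  assumes der: "(u has_vector_derivative fcl A B K ub (u t)) (at t within X)"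
  shows "((\<lambda>t. V (u t)) has_real_derivative flow_rate (u t)) (at t within X)"
proof -
  let ?x = "\<lambda>t. fst (u t)" and ?\<eta> = "\<lambda>t. fst (snd (u t))" and ?\<tau> = "\<lambda>t. snd (snd (u t))"
  define x' where "x' = (A + B ** K) *v ?x t - (B ** K) *v ?\<eta> t + B *v dz ub (K *v ?x t - K *v ?\<eta> t)"
  define e where "e k s = exp (\<sigma> (blk k) * ?\<tau> s $ (blk k))" for k s
  note dx = flow_components(1)[OF der, folded x'_def]
  note d\<eta> = flow_components(2)[OF der]
  note d\<tau> = flow_components(3)[OF der]
  have comp: "((\<lambda>t. (M *v f t) $ k) has_real_derivative (M *v f') $ k) (at t within X)"
    if "(f has_vector_derivative f') (at t within X)"
    for M :: "real^'a::finite^'b::finite" and f f' k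
    using bounded_linear.has_vector_derivative[OF bounded_linear_vec_nth
        bounded_linear.has_vector_derivative[OF matrix_vector_mul_bounded_linear that]]
    by (simp add: has_real_derivative_iff_has_vector_derivative)
  have "((\<lambda>t. inner (?x t) (matrix_inv W *v ?x t)) has_vector_derivative
      inner (?x t) (matrix_inv W *v x') + inner x' (matrix_inv W *v ?x t)) (at t within X)"
    by (intro bounded_bilinear.has_vector_derivative[OF bounded_bilinear_inner] dx
        bounded_linear.has_vector_derivative[OF matrix_vector_mul_bounded_linear])
  then have 1: "((\<lambda>t. inner (?x t) (matrix_inv W *v ?x t)) has_real_derivative
      2 * inner (matrix_inv W *v ?x t) x') (at t within X)"
    using inner_symmetric_matrix[OF W_inverse(2), of "?x t" x']
    by (simp add: has_real_derivative_iff_has_vector_derivative inner_commute)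
  \<comment> \<open>Differentiated coordinate by coordinate, because each row of \<open>R\<close>
    carries its own time-dependent weight.\<close>
  have "((\<lambda>s. \<Sum>k\<in>UNIV. ?\<eta> s $ k * (e k s * (Rb *v ?\<eta> s) $ k)) has_real_derivative
      (\<Sum>k\<in>UNIV. ?\<eta> t $ k * (- \<sigma> (blk k) * e k t * (Rb *v ?\<eta> t) $ k + e k t * (Rb *v (A *v ?\<eta> t)) $ k)
        + (A *v ?\<eta> t) $ k * (e k t * (Rb *v ?\<eta> t) $ k))) (at t within X)"
  proof (rule DERIV_sum)
    fix k
    have de: "(e k has_real_derivative - \<sigma> (blk k) * e k t) (at t within X)"
      unfolding e_def by (auto intro!: derivative_eq_intros d\<tau>)
    have d\<eta>k: "((\<lambda>s. ?\<eta> s $ k) has_real_derivative (A *v ?\<eta> t) $ k) (at t within X)"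
      using comp[OF d\<eta>, of "mat 1" k] by simp
    show "((\<lambda>s. ?\<eta> s $ k * (e k s * (Rb *v ?\<eta> s) $ k)) has_real_derivative
      ?\<eta> t $ k * (- \<sigma> (blk k) * e k t * (Rb *v ?\<eta> t) $ k + e k t * (Rb *v (A *v ?\<eta> t)) $ k)
        + (A *v ?\<eta> t) $ k * (e k t * (Rb *v ?\<eta> t) $ k)) (at t within X)"
      by (auto intro!: derivative_eq_intros de d\<eta>k comp[OF d\<eta>] simp: algebra_simps)
  qed
  moreover have "(\<Sum>k\<in>UNIV. ?\<eta> t $ k * (- \<sigma> (blk k) * e k t * (Rb *v ?\<eta> t) $ k + e k t * (Rb *v (A *v ?\<eta> t)) $ k)
        + (A *v ?\<eta> t) $ k * (e k t * (Rb *v ?\<eta> t) $ k))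
      = 2 * inner (?\<eta> t) (R (?\<tau> t) *v (A *v ?\<eta> t)) - inner (?\<eta> t) (Sig blk \<sigma> *v (R (?\<tau> t) *v ?\<eta> t))"
  proof -
    \<comment> \<open>Symmetry of \<open>R\<close> merges the two terms containing \<open>A\<close>
      into the factor 2 of \<open>flow_rate\<close>.\<close>
    have "inner (?\<eta> t) (R (?\<tau> t) *v (A *v ?\<eta> t)) = inner (A *v ?\<eta> t) (R (?\<tau> t) *v ?\<eta> t)"
      by (rule inner_symmetric_matrix[OF Rtau_symmetric[OF Rb_blockdiag Rb_sym]])
    then have "2 * inner (?\<eta> t) (R (?\<tau> t) *v (A *v ?\<eta> t))
        = inner (?\<eta> t) (R (?\<tau> t) *v (A *v ?\<eta> t)) + inner (A *v ?\<eta> t) (R (?\<tau> t) *v ?\<eta> t)"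
      by simp
    then show ?thesis
      by (simp add: inner_vec_def Rtau_mult_component Sig_mult_component e_def
          sum.distrib sum_subtractf sum_negf algebra_simps)
  qed
  moreover have "(\<lambda>s. \<Sum>k\<in>UNIV. ?\<eta> s $ k * (e k s * (Rb *v ?\<eta> s) $ k)) = (\<lambda>s. inner (?\<eta> s) (R (?\<tau> s) *v ?\<eta> s))"
    by (simp add: inner_vec_def Rtau_mult_component e_def)
  ultimately have 2: "((\<lambda>s. inner (?\<eta> s) (R (?\<tau> s) *v ?\<eta> s)) has_real_derivative
      2 * inner (?\<eta> t) (R (?\<tau> t) *v (A *v ?\<eta> t)) - inner (?\<eta> t) (Sig blk \<sigma> *v (R (?\<tau> t) *v ?\<eta> t))) (at t within X)"
    by simp
  show ?thesis
    using DERIV_add[OF 1 2] by (simp add: V_def flow_rate_def case_prod_unfold x'_def algebra_simps)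
qed

section \<open>Estimates along whole solutions: decay, number of jumps, completeness\<close>

abbreviation maximal where
  "maximal \<equiv> maximal_solution (Ccl T2) (fcl A B K ub) (Dcl T2) (Gcl blk T1 T2)"

abbreviation solution where
  "solution \<equiv> hybrid_solution (Ccl T2) (fcl A B K ub) (Dcl T2) (Gcl blk T1 T2)"

lemma continuous_fcl: "continuous_on UNIV (fcl A B K ub :: _ \<Rightarrow> _ \<times> _ \<times> (real^'q))"
  using fcl_lipschitz[OF ub_pos] lipschitz_on_continuous_on by blast

lemma solution_in_Ccl: "solution E \<phi> \<Longrightarrow> (t, j) \<in> E \<Longrightarrow> \<phi> (t, j) \<in> Ccl T2"
  by (rule hybrid_solution_in_flow_set[OF _ continuous_fcl closed_Ccl Dcl_subset_Ccl Gcl_subset_Ccl])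

lemma V_nonneg: "x \<in> Ccl T2 \<Longrightarrow> 0 \<le> V x"
proof -
  assume x: "x \<in> Ccl T2"
  obtain xp \<eta> \<tau> where [simp]: "x = (xp, \<eta>, \<tau>)"
    by (cases x)
  obtain m1 m2 where m: "m1 > 0"
    "\<And>xp \<eta> \<tau>. \<tau> \<in> Tset T2 \<Longrightarrow> m1 * (norm (xp, \<eta>))\<^sup>2 \<le> V (xp, \<eta>, \<tau>)"
    using V_bounds by metis
  have "0 \<le> m1 * (norm (xp, \<eta>))\<^sup>2"
    using m(1) by simp
  also have "\<dots> \<le> V x"
    using m(2)[of \<tau> xp \<eta>] x by (simp add: Ccl_def)
  finally show ?thesis .
qed

lemma V_decay:
  assumes sol: "solution E \<phi>" and V0: "V (\<phi> (0, 0)) \<le> \<mu>"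
    and c: "c > 0" "\<And>xp \<eta> \<tau>. \<tau> \<in> Tset T2 \<Longrightarrow> V (xp, \<eta>, \<tau>) \<le> \<mu> \<Longrightarrow>
        flow_rate (xp, \<eta>, \<tau>) \<le> - c * V (xp, \<eta>, \<tau>)"
    and mem: "(t, j) \<in> E"
  shows "V (\<phi> (t, j)) \<le> V (\<phi> (0, 0)) * exp (- c * t)"
proof -
  have htd: "hybrid_time_domain E"
    using sol by (simp add: hybrid_solution_def)
  then have "(0, 0) \<in> E"
    by (simp add: hybrid_time_domain_def)
  then have V00: "0 \<le> V (\<phi> (0, 0))"
    using solution_in_Ccl[OF sol] V_nonneg by blast
  from htd mem show ?thesis
  proof (induction rule: hybrid_induct)
    case start
    then show ?case
      by simp
  next
    case (flow a t j)
    have seg: "{a..t} \<subseteq> slice E j"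
      using slice_segment[OF htd flow(3,4)] .
    \<comment> \<open>The induction hypothesis already keeps the start of this flow stretch in the
      sublevel set, where the rate estimate can be used again.\<close>
    have "exp (- c * a) \<le> 1"
      using slice_nonneg[OF htd flow(3)] c(1) by simp
    then have "V (\<phi> (0, 0)) * exp (- c * a) \<le> V (\<phi> (0, 0))"
      using V00 by (rule mult_left_le)
    then have Va: "V (\<phi> (a, j)) \<le> \<mu>"
      using flow(1) V0 by linarith
    have "V (\<phi> (t, j)) \<le> V (\<phi> (a, j)) * exp (- c * (t - a))"
    proof (rule decay_below_level[where v = "\<lambda>s. V (\<phi> (s, j))" and v' = "\<lambda>s. flow_rate (\<phi> (s, j))"
          and b = t and \<mu> = \<mu>])
      fix s
      assume s: "s \<in> {a..t}"
      show "((\<lambda>s. V (\<phi> (s, j))) has_real_derivative flow_rate (\<phi> (s, j))) (at s within {a..t})"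
        by (rule V_flow[OF hybrid_solution_flow(3)[OF sol seg continuous_fcl s]])
      have "(s, j) \<in> E"
        using seg s by (auto dest: subsetD)
      then have "\<phi> (s, j) \<in> Ccl T2"
        by (rule solution_in_Ccl[OF sol])
      then show "flow_rate (\<phi> (s, j)) \<le> - c * V (\<phi> (s, j))" if "V (\<phi> (s, j)) \<le> \<mu>"
        using c(2) that by (cases "\<phi> (s, j)") (auto simp: Ccl_def)
    qed (use c(1) \<mu>_pos Va flow(2) in auto)
    also have "\<dots> \<le> V (\<phi> (0, 0)) * exp (- c * a) * exp (- c * (t - a))"
      using flow(1) by (intro mult_right_mono) auto
    also have "\<dots> = V (\<phi> (0, 0)) * exp (- c * t)"
      by (simp add: mult.assoc exp_add[symmetric] algebra_simps)
    finally show ?case .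
  next
    case (jump t j)
    then have "\<phi> (t, Suc j) \<in> Gcl blk T1 T2 (\<phi> (t, j))"
      using sol by (simp add: hybrid_solution_def)
    then show ?case
      using V_jump jump(1) by fastforce
  qed
qed

text \<open>Between jumps the sum of the timers decreases at rate \<open>CARD('q)\<close>, and each jump raises it by
  at least \<open>Tm\<close>; as it stays bounded, the jumps are controlled by the ordinary time.\<close>
lemma jump_count_bound:
  assumes sol: "solution E \<phi>" and Tm: "\<And>i. Tm \<le> T1 i" and mem: "(t, j) \<in> E"
  shows "real j * Tm \<le> (\<Sum>i\<in>UNIV. T2 i) + real CARD('q) * t"
proof -
  have htd: "hybrid_time_domain E"
    using sol by (simp add: hybrid_solution_def)
  have timers: "snd (snd (\<phi> (t, j))) \<in> Tset T2" if "(t, j) \<in> E" for t j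
    using solution_in_Ccl[OF sol that] by (cases "\<phi> (t, j)") (auto simp: Ccl_def)
  define \<theta> where "\<theta> t j = (\<Sum>i\<in>UNIV. snd (snd (\<phi> (t, j))) $ i)" for t j
  from htd mem have "real j * Tm \<le> \<theta> t j + real CARD('q) * t"
  proof (induction rule: hybrid_induct)
    case start
    have "(0, 0) \<in> E"
      using htd by (simp add: hybrid_time_domain_def)
    from timers[OF this] show ?case
      by (auto simp: \<theta>_def Tset_def intro!: sum_nonneg)
  next
    case (flow a t j)
    note seg = slice_segment[OF htd flow(3,4)]
    have "snd (snd (\<phi> (t, j))) $ i = snd (snd (\<phi> (a, j))) $ i - (t - a)" for i
      by (rule timer_flow[where u = "\<lambda>s. \<phi> (s, j)", OF hybrid_solution_flow(3)[OF sol seg continuous_fcl]])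
        (use flow(2) in auto)
    then have "\<theta> t j = \<theta> a j - real CARD('q) * (t - a)"
      by (simp add: \<theta>_def sum_subtractf)
    then show ?case
      using flow(1) by (simp add: algebra_simps)
  next
    case (jump t j)
    then have "\<phi> (t, Suc j) \<in> Gcl blk T1 T2 (\<phi> (t, j))"
      using sol by (simp add: hybrid_solution_def)
    from timer_sum_jump[OF this Tm] show ?case
      using jump(1) by (simp add: \<theta>_def algebra_simps)
  qed
  moreover have "\<theta> t j \<le> (\<Sum>i\<in>UNIV. T2 i)"
    using timers[OF mem] unfolding \<theta>_def by (intro sum_mono) (simp add: Tset_def)
  ultimately show ?thesis
    by linarith
qed

text \<open>\<open>V\<close> keeps the plant state and \<eta> bounded and \<open>Tset T2\<close>
  bounds the timers, which gives the bound needed by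
  \<open>maximal_solution_complete\<close>.\<close>

lemma maximal_complete:
  assumes max: "maximal E \<phi>" and V0: "V (\<phi> (0, 0)) \<le> \<mu>"
  shows "complete_domain E"
proof -
  have sol: "solution E \<phi>"
    using max by (simp add: maximal_solution_def)
  have htd: "hybrid_time_domain E"
    using sol by (simp add: hybrid_solution_def)
  obtain c where c: "c > 0" "\<And>xp \<eta> \<tau>. \<tau> \<in> Tset T2 \<Longrightarrow> V (xp, \<eta>, \<tau>) \<le> \<mu> \<Longrightarrow>
        flow_rate (xp, \<eta>, \<tau>) \<le> - c * V (xp, \<eta>, \<tau>)"
    using flow_rate_decay by blast
  obtain m1 m2 where m: "m1 > 0" "\<And>xp \<eta> \<tau>. \<tau> \<in> Tset T2 \<Longrightarrow> m1 * (norm (xp, \<eta>))\<^sup>2 \<le> V (xp, \<eta>, \<tau>)"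
    using V_bounds by metis
  obtain r where r: "\<And>\<tau>. \<tau> \<in> Tset T2 \<Longrightarrow> norm \<tau> \<le> r"
    using compact_imp_bounded[OF compact_Tset] unfolding bounded_iff by blast
  obtain L where L: "L-lipschitz_on UNIV (fcl A B K ub :: _ \<Rightarrow> _ \<times> _ \<times> (real^'q))"
    using fcl_lipschitz[OF ub_pos] by blast
  show ?thesis
  proof (rule maximal_solution_complete[OF max L closed_Ccl Dcl_subset_Ccl Gcl_subset_Ccl Gcl_nonempty Ccl_viable])
    fix t j
    assume tj: "(t, j) \<in> E"
    obtain xp \<eta> \<tau> where x: "\<phi> (t, j) = (xp, \<eta>, \<tau>)"
      by (cases "\<phi> (t, j)")
    have \<tau>: "\<tau> \<in> Tset T2"
      using solution_in_Ccl[OF sol tj] x by (simp add: Ccl_def)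
    have "(0, 0) \<in> E"
      using htd by (simp add: hybrid_time_domain_def)
    then have V00: "0 \<le> V (\<phi> (0, 0))"
      using solution_in_Ccl[OF sol] V_nonneg by blast
    have "V (xp, \<eta>, \<tau>) \<le> V (\<phi> (0, 0)) * exp (- c * t)"
      using V_decay[OF sol V0 c tj] x by simp
    also have "\<dots> \<le> V (\<phi> (0, 0))"
      using slice_nonneg[OF htd tj] c(1) V00 by (intro mult_left_le) auto
    also have "\<dots> \<le> \<mu>"
      by (rule V0)
    finally have "m1 * (norm (xp, \<eta>))\<^sup>2 \<le> \<mu>"
      using m(2)[OF \<tau>, of xp \<eta>] by linarith
    then have "(norm (xp, \<eta>))\<^sup>2 \<le> \<mu> / m1"
      using m(1) by (simp add: field_simps)
    then have "norm (xp, \<eta>) \<le> sqrt (\<mu> / m1)"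
      by (rule real_le_rsqrt)
    moreover have "norm (xp, \<eta>, \<tau>) \<le> norm (xp, \<eta>) + norm \<tau>"
      using sqrt_add_le_add_sqrt[of "(norm xp)\<^sup>2 + (norm \<eta>)\<^sup>2" "(norm \<tau>)\<^sup>2"]
      by (simp add: norm_Pair add.assoc)
    ultimately show "norm (\<phi> (t, j)) \<le> sqrt (\<mu> / m1) + r"
      using r[OF \<tau>] x by simp
  qed
qed

lemma exponential_estimate:
  obtains \<kappa> lam where "\<kappa> > 0" "lam > 0"
    "\<And>E \<phi> t j. \<lbrakk>solution E \<phi>; V (\<phi> (0, 0)) \<le> \<mu>; (t, j) \<in> E\<rbrakk> \<Longrightarrow>
      infdist (\<phi> (t, j)) (Aset T2) \<le> \<kappa> * exp (- lam * (t + real j)) * infdist (\<phi> (0, 0)) (Aset T2)"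
proof -
  obtain c where c: "c > 0" "\<And>xp \<eta> \<tau>. \<tau> \<in> Tset T2 \<Longrightarrow> V (xp, \<eta>, \<tau>) \<le> \<mu> \<Longrightarrow>
        flow_rate (xp, \<eta>, \<tau>) \<le> - c * V (xp, \<eta>, \<tau>)"
    using flow_rate_decay by blast
  obtain m1 m2 where m: "m1 > 0" "m2 > 0"
    "\<And>xp \<eta> \<tau>. \<tau> \<in> Tset T2 \<Longrightarrow> m1 * (norm (xp, \<eta>))\<^sup>2 \<le> V (xp, \<eta>, \<tau>)"
    "\<And>xp \<eta> \<tau>. \<tau> \<in> Tset T2 \<Longrightarrow> V (xp, \<eta>, \<tau>) \<le> m2 * (norm (xp, \<eta>))\<^sup>2"
    using V_bounds by blast
  define Tm where "Tm = Min (range T1)"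
  have Tm: "Tm > 0" "\<And>i. Tm \<le> T1 i"
    using T_pos by (auto simp: Tm_def)
  define q where "q = real CARD('q)"
  have q: "q > 0"
    by (simp add: q_def)
  define T where "T = (\<Sum>i\<in>UNIV. T2 i)"
  \<comment> \<open>The decay exponent \<open>c * t\<close> is split in halves: one pays for
    \<open>l * t\<close>, the other, by \<open>jump_count_bound\<close>, for \<open>l * j\<close> up
    to the constant \<open>c * T / (2 * q)\<close>. The minimum makes both payments
    possible.\<close>
  define l where "l = c * min (1/2) (Tm / (2 * q))"
  have l: "l > 0" "l \<le> c / 2" "l \<le> c * Tm / (2 * q)"
  proof -
    show "l > 0"
      using c(1) Tm(1) q by (simp add: l_def)
    have "l \<le> c * (1/2)" "l \<le> c * (Tm / (2 * q))"
      unfolding l_def using c(1) by (intro mult_left_mono; simp)+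
    then show "l \<le> c / 2" "l \<le> c * Tm / (2 * q)"
      by auto
  qed
  \<comment> \<open>The ratio comes from comparing \<open>V\<close> with the norm at both ends, the
    exponential from the constant in the jump count.\<close>
  define C where "C = m2 / m1 * exp (c * T / (2 * q))"
  have C: "C > 0"
    using m by (simp add: C_def)
  show ?thesis
  \<comment> \<open>\<open>V\<close> is quadratic in the distance, so constant and rate pass through
    a square root.\<close>
  proof (rule that[of "sqrt C" "l / 2"])
    fix E \<phi> t j
    assume sol: "solution E \<phi>" and V0: "V (\<phi> (0, 0)) \<le> \<mu>" and tj: "(t, j) \<in> E"
    have htd: "hybrid_time_domain E"
      using sol by (simp add: hybrid_solution_def)
    then have z: "(0, 0) \<in> E"
      by (simp add: hybrid_time_domain_def)
    obtain xp \<eta> \<tau> where x: "\<phi> (t, j) = (xp, \<eta>, \<tau>)"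
      by (cases "\<phi> (t, j)")
    obtain xp0 \<eta>0 \<tau>0 where x0: "\<phi> (0, 0) = (xp0, \<eta>0, \<tau>0)"
      by (cases "\<phi> (0, 0)")
    have \<tau>: "\<tau> \<in> Tset T2" "\<tau>0 \<in> Tset T2"
      using solution_in_Ccl[OF sol tj] solution_in_Ccl[OF sol z] x x0 by (auto simp: Ccl_def)
    have t: "0 \<le> t"
      using slice_nonneg[OF htd tj] .
    have "l * t \<le> c / 2 * t"
      using l(2) t by (rule mult_right_mono)
    moreover have "l * real j \<le> c * Tm / (2 * q) * real j"
      using l(3) by (rule mult_right_mono) simp
    moreover have "c * Tm / (2 * q) * real j \<le> c * T / (2 * q) + c / 2 * t"
    proof -
      have "real j * Tm \<le> T + q * t"
        using jump_count_bound[OF sol Tm(2) tj] by (simp add: T_def q_def)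
      then have "c / (2 * q) * (real j * Tm) \<le> c / (2 * q) * (T + q * t)"
        using c(1) q by (intro mult_left_mono) auto
      then show ?thesis
        using q by (simp add: field_simps)
    qed
    ultimately have "l * (t + real j) \<le> c * T / (2 * q) + c * t"
      by (simp add: distrib_left)
    then have e: "exp (- c * t) \<le> exp (c * T / (2 * q)) * exp (- l * (t + real j))"
      by (simp add: exp_add[symmetric])
    have "m1 * (norm (xp, \<eta>))\<^sup>2 \<le> V (\<phi> (0, 0)) * exp (- c * t)"
      using V_decay[OF sol V0 c tj] m(3)[OF \<tau>(1), of xp \<eta>] x by simp
    also have "\<dots> \<le> m2 * (norm (xp0, \<eta>0))\<^sup>2 * (exp (c * T / (2 * q)) * exp (- l * (t + real j)))"
      using m(2) m(4)[OF \<tau>(2), of xp0 \<eta>0] e x0 by (intro mult_mono) auto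
    finally have "(norm (xp, \<eta>))\<^sup>2 \<le> C * exp (- l * (t + real j)) * (norm (xp0, \<eta>0))\<^sup>2"
      using m(1) by (simp add: C_def field_simps)
    then have "norm (xp, \<eta>) \<le> sqrt (C * exp (- l * (t + real j)) * (norm (xp0, \<eta>0))\<^sup>2)"
      by (rule real_le_rsqrt)
    also have "\<dots> = sqrt C * exp (- (l / 2) * (t + real j)) * norm (xp0, \<eta>0)"
    proof -
      have "sqrt (exp (- l * (t + real j))) = exp (- (l / 2) * (t + real j))"
        by (rule real_sqrt_unique) (simp_all add: power2_eq_square exp_add[symmetric])
      then show ?thesis
        by (simp add: real_sqrt_mult)
    qed
    finally show "infdist (\<phi> (t, j)) (Aset T2)
        \<le> sqrt C * exp (- (l / 2) * (t + real j)) * infdist (\<phi> (0, 0)) (Aset T2)"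
      by (simp add: x x0 infdist_Aset \<tau>)
  qed (use C l in auto)
qed

section \<open>Exponential stability and the basin of attraction\<close>

lemma mem_Qset: "x \<in> Qset T2 W blk \<sigma> Rb \<mu> \<longleftrightarrow> x \<in> Ccl T2 \<and> V x \<le> \<mu>"
  by (auto simp: Qset_def V_def)

lemma exp_stable_Aset: "exp_stable (Ccl T2) (fcl A B K ub) (Dcl T2) (Gcl blk T1 T2) (Aset T2)"
proof -
  obtain \<kappa> lam where \<kappa>: "\<kappa> > 0" "lam > 0"
    "\<And>E \<phi> t j. \<lbrakk>solution E \<phi>; V (\<phi> (0, 0)) \<le> \<mu>; (t, j) \<in> E\<rbrakk> \<Longrightarrow>
      infdist (\<phi> (t, j)) (Aset T2) \<le> \<kappa> * exp (- lam * (t + real j)) * infdist (\<phi> (0, 0)) (Aset T2)"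
    using exponential_estimate by blast
  obtain m1 m2 where m: "m2 > 0" "\<And>xp \<eta> \<tau>. \<tau> \<in> Tset T2 \<Longrightarrow> V (xp, \<eta>, \<tau>) \<le> m2 * (norm (xp, \<eta>))\<^sup>2"
    using V_bounds by metis
  \<comment> \<open>The radius \<open>sqrt (\<mu> / m2)\<close> is chosen so that the upper bound on
    \<open>V\<close> places the start in the sublevel set.\<close>
  have "complete_domain E \<and> (\<forall>(t, j)\<in>E. infdist (\<phi> (t, j)) (Aset T2)
      \<le> \<kappa> * exp (- lam * (t + real j)) * infdist (\<phi> (0, 0)) (Aset T2))"
    if max: "maximal E \<phi>" and d: "infdist (\<phi> (0, 0)) (Aset T2) \<le> sqrt (\<mu> / m2)" for E \<phi>
  proof -
    have sol: "solution E \<phi>"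
      using max by (simp add: maximal_solution_def)
    have "(0, 0) \<in> E"
      using sol by (simp add: hybrid_solution_def hybrid_time_domain_def)
    obtain xp \<eta> \<tau> where x: "\<phi> (0, 0) = (xp, \<eta>, \<tau>)"
      by (cases "\<phi> (0, 0)")
    have \<tau>: "\<tau> \<in> Tset T2"
      using solution_in_Ccl[OF sol \<open>(0, 0) \<in> E\<close>] x by (simp add: Ccl_def)
    have "(norm (xp, \<eta>))\<^sup>2 \<le> (sqrt (\<mu> / m2))\<^sup>2"
      using d by (intro power_mono) (auto simp: x infdist_Aset[OF \<tau>])
    also have "\<dots> = \<mu> / m2"
      using \<mu>_pos m(1) by simp
    finally have "m2 * (norm (xp, \<eta>))\<^sup>2 \<le> \<mu>"
      using m(1) by (simp add: field_simps)
    then have V0: "V (\<phi> (0, 0)) \<le> \<mu>"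
      using m(2)[OF \<tau>, of xp \<eta>] x by simp
    show ?thesis
      using maximal_complete[OF max V0] \<kappa>(3)[OF sol V0] by auto
  qed
  moreover have "sqrt (\<mu> / m2) > 0"
    using \<mu>_pos m(1) by simp
  ultimately show ?thesis
    unfolding exp_stable_def using \<kappa>(1,2) by blast
qed

lemma Qset_estimate:
  "\<exists>lam>0. \<exists>\<kappa>>0. \<forall>E \<phi>. maximal E \<phi> \<and> \<phi> (0, 0) \<in> Qset T2 W blk \<sigma> Rb \<mu> \<longrightarrow>
     (\<forall>(t, j)\<in>E. infdist (\<phi> (t, j)) (Aset T2)
        \<le> \<kappa> * exp (- lam * (t + real j)) * infdist (\<phi> (0, 0)) (Aset T2))"
proof -
  obtain \<kappa> lam where \<kappa>: "\<kappa> > 0" "lam > 0"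
    "\<And>E \<phi> t j. \<lbrakk>solution E \<phi>; V (\<phi> (0, 0)) \<le> \<mu>; (t, j) \<in> E\<rbrakk> \<Longrightarrow>
      infdist (\<phi> (t, j)) (Aset T2) \<le> \<kappa> * exp (- lam * (t + real j)) * infdist (\<phi> (0, 0)) (Aset T2)"
    using exponential_estimate by blast
  have "\<forall>(t, j)\<in>E. infdist (\<phi> (t, j)) (Aset T2)
        \<le> \<kappa> * exp (- lam * (t + real j)) * infdist (\<phi> (0, 0)) (Aset T2)"
    if "maximal E \<phi>" "\<phi> (0, 0) \<in> Qset T2 W blk \<sigma> Rb \<mu>" for E \<phi>
    using \<kappa>(3)[of E \<phi>] that by (auto simp: mem_Qset maximal_solution_def)
  then show ?thesis
    using \<kappa>(1,2) by blast
qed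

lemma Qset_subset_basin:
  "Qset T2 W blk \<sigma> Rb \<mu> \<subseteq> basin (Ccl T2) (fcl A B K ub) (Dcl T2) (Gcl blk T1 T2) (Aset T2)"
proof
  fix x
  assume x: "x \<in> Qset T2 W blk \<sigma> Rb \<mu>"
  obtain lam \<kappa> where l: "lam > 0" "\<kappa> > 0" and est: "\<And>E \<phi> t j. \<lbrakk>maximal E \<phi>;
      \<phi> (0, 0) \<in> Qset T2 W blk \<sigma> Rb \<mu>; (t, j) \<in> E\<rbrakk> \<Longrightarrow> infdist (\<phi> (t, j)) (Aset T2)
        \<le> \<kappa> * exp (- lam * (t + real j)) * infdist (\<phi> (0, 0)) (Aset T2)"
    using Qset_estimate by fastforce
  have "complete_domain E \<and>
       (\<forall>\<epsilon>>0. \<exists>M. \<forall>(t, j)\<in>E. t + real j \<ge> M \<longrightarrow> infdist (\<phi> (t, j)) (Aset T2) < \<epsilon>)"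
    if max: "maximal E \<phi>" and \<phi>: "\<phi> (0, 0) = x" for E \<phi>
  proof (intro conjI allI impI)
    show "complete_domain E"
      using maximal_complete[OF max] x \<phi> by (simp add: mem_Qset)
    fix \<epsilon> :: real
    assume \<epsilon>: "\<epsilon> > 0"
    define d where "d = infdist x (Aset T2)"
    have "((\<lambda>r. \<kappa> * exp (- lam * r) * d) \<longlongrightarrow> \<kappa> * 0 * d) at_top"
      using l(1) by (intro tendsto_intros filterlim_compose[OF exp_at_bot]
          filterlim_tendsto_neg_mult_at_bot[OF tendsto_const _ filterlim_ident]) auto
    then have "\<forall>\<^sub>F r in at_top. \<kappa> * exp (- lam * r) * d < \<epsilon>"
      using order_tendstoD(2) \<epsilon> by fastforce
    then obtain M where M: "\<And>r. r \<ge> M \<Longrightarrow> \<kappa> * exp (- lam * r) * d < \<epsilon>"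
      by (auto simp: eventually_at_top_linorder)
    have "infdist (\<phi> (t, j)) (Aset T2) < \<epsilon>" if "(t, j) \<in> E" "t + real j \<ge> M" for t j
      using est[OF max _ that(1)] M[OF that(2)] x \<phi> by (auto simp: d_def)
    then show "\<exists>M. \<forall>(t, j)\<in>E. t + real j \<ge> M \<longrightarrow> infdist (\<phi> (t, j)) (Aset T2) < \<epsilon>"
      by blast
  qed
  then show "x \<in> basin (Ccl T2) (fcl A B K ub) (Dcl T2) (Gcl blk T1 T2) (Aset T2)"
    unfolding basin_def by blast
qed

end

theorem theorem1:
  fixes A :: "real^'n::finite^'n" and B :: "real^'m::finite^'n" and K :: "real^'n^'m"
    and ub :: "real^'m" and blk :: "'n \<Rightarrow> 'q::finite" and T1 T2 :: "'q \<Rightarrow> real"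
    and W Rb :: "real^'n^'n" and S :: "real^'m^'m" and \<sigma> :: "'q \<Rightarrow> real"
    and \<mu> :: real and Z J :: "real^'n^'m"
  assumes blocks: "surj blk"
    and ub_pos: "\<forall>i. 0 < ub$i"
    and T_pos: "\<forall>i. 0 < T1 i \<and> T1 i \<le> T2 i"
    and W_sym: "transpose W = W"
    and W_pd: "\<forall>v. v \<noteq> 0 \<longrightarrow> 0 < inner v (W *v v)"
    and Rb_blockdiag: "\<forall>k l. blk k \<noteq> blk l \<longrightarrow> Rb$k$l = 0"
    and Rb_sym: "transpose Rb = Rb"
    and Rj_pd: "\<forall>j v. v \<noteq> 0 \<and> (\<forall>k. blk k \<noteq> j \<longrightarrow> v$k = 0) \<longrightarrow> 0 < inner v (Rb *v v)"
    and S_diag: "\<forall>i k. i \<noteq> k \<longrightarrow> S$i$k = 0"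
    and S_pos: "\<forall>i. 0 < S$i$i"
    and \<sigma>_pos: "\<forall>j. 0 < \<sigma> j"
    and \<mu>_pos: "0 < \<mu>"
    and lmi1: "\<forall>i. psd_op (LMI1 W Rb Z J ub \<mu> i)"
    and lmi2: "\<forall>\<tau>\<in>Tset T2. nd_op (Mtau A B K W Z J S blk \<sigma> Rb \<tau>)"
  shows "exp_stable (Ccl T2) (fcl A B K ub) (Dcl T2) (Gcl blk T1 T2) (Aset T2) \<and>
         Qset T2 W blk \<sigma> Rb \<mu> \<subseteq> basin (Ccl T2) (fcl A B K ub) (Dcl T2) (Gcl blk T1 T2) (Aset T2) \<and>
         (\<exists>lam>0. \<exists>\<kappa>>0. \<forall>E \<phi>.
            maximal_solution (Ccl T2) (fcl A B K ub) (Dcl T2) (Gcl blk T1 T2) E \<phi> \<and>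
            \<phi> (0, 0) \<in> Qset T2 W blk \<sigma> Rb \<mu> \<longrightarrow>
            (\<forall>(t, j)\<in>E. infdist (\<phi> (t, j)) (Aset T2)
                 \<le> \<kappa> * exp (- lam * (t + real j)) * infdist (\<phi> (0, 0)) (Aset T2)))"
proof -
  interpret saturated_lmi A B K ub blk T1 T2 W Rb S \<sigma> \<mu> Z J
    by unfold_locales (fact assms)+
  show ?thesis
    using exp_stable_Aset Qset_subset_basin Qset_estimate by blast
qed

end
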